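(* Let $n\ge 1$ be an integer, let $\alpha\in(0,2)$, and let $f,g\in C^1([0,+\infty)\times[0,+\infty),\mathbb{R})$. Let $u,v\in L_\alpha\cap C^{1,1}_{loc}(\mathbb{R}^n)$ be a positive solution of the system $$(-\Delta)^{\alpha/2}u(x)=f(u(x),v(x)),\quad (-\Delta)^{\alpha/2}v(x)=g(u(x),v(x)),\quad u(x)>0,\ v(x)>0,\qquad x\in\mathbb{R}^n.$$ Let $a,b>0$ and $p,q,r,s\ge 1$ be real numbers and suppose that: (i) $u(x)\lesssim |x|^{-a}$ and $v(x)\lesssim |x|^{-b}$ as $|x|\to\infty$; (ii) $\frac{\partial f}{\partial u}(u,v)\lesssim u^{p-1}v^{q}$ and $\frac{\partial g}{\partial v}(u,v)\lesssim u^{r}v^{s-1}$ as $(u,v)\to(0^+,0^+)$; (iii) $\frac{\partial f}{\partial v}(u,v)\lesssim u^{p}v^{q-1}$ and $\frac{\partial g}{\partial u}(u,v)\lesssim u^{r-1}v^{s}$ as $(u,v)\to(0^+,0^+)$; (iv) $\frac{\partial f}{\partial v}(u,v)>0$ and $\frac{\partial g}{\partial u}(u,v)>0$ for all $(u,v)\in(0,\infty)\times(0,\infty)$; (v) $\alpha<\min\{ap+bq-a,\ ap+bq-b,\ ar+bs-a,\ ar+bs-b\}$. Then there exists a point $x_0\in\mathbb{R}^n$ such that both $u$ and $v$ are radially symmetric about $x_0$, i.e. $u(x)$ and $v(x)$ depend only on $|x-x_0|$.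
   Context: For $\alpha\in(0,2)$, the fractional Laplacian is $$(-\Delta)^{\alpha/2}u(x)=C_{n,\alpha}\lim_{\epsilon\to0}\int_{\mathbb{R}^n\setminus B_\epsilon(x)}\frac{u(x)-u(y)}{|x-y|^{n+\alpha}}\,dy,$$ where $C_{n,\alpha}>0$ is a normalization constant. $L_\alpha$ is the set of functions $u:\mathbb{R}^n\to\mathbb{R}$ with $\int_{\mathbb{R}^n}\frac{|u(x)|}{1+|x|^{n+\alpha}}dx<+\infty$. $C^{1,1}_{loc}(\mathbb{R}^n)$ is the set of $C^1$ functions with locally Lipschitz gradient. For $u\in L_\alpha\cap C^{1,1}_{loc}(\mathbb{R}^n)$ the limit as $\epsilon\to0$ defining $(-\Delta)^{\alpha/2}u(x)$ is well defined at every point, and equations are understood pointwise. The notation $A\lesssim B$ in a limit means that $A\le B$ (with constant 1) sufficiently near the limit: $u(x)\lesssim|x|^{-a}$ as $|x|\to\infty$ means there is $R>0$ with $u(x)\le|x|^{-a}$ for all $|x|>R$; $A(u,v)\lesssim B(u,v)$ as $(u,v)\to(0^+,0^+)$ means there is $\delta>0$ with $A(u,v)\le B(u,v)$ for all $u,v>0$ with $u+v<\delta$. *)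

theory Defs
  imports "HOL-Analysis.Analysis"
begin

text \<open>The constant \<open>C\<close> is the normalization constant of the operator, which depends only on
  the dimension and on \<open>\<alpha>\<close>; it is a parameter here, as only its positivity is prescribed.
  The value is the limit itself whenever the limit exists, which is the case at every point for
  \<open>u\<close> in \<open>L_space \<alpha> \<inter> C11_loc\<close> and \<open>0 < \<alpha> < 2\<close>.\<close>

definition frac_laplacian ::
    "real \<Rightarrow> real \<Rightarrow> ('a::euclidean_space \<Rightarrow> real) \<Rightarrow> 'a \<Rightarrow> real" where
  "frac_laplacian C \<alpha> u x =
     C * Lim (at_right 0) (\<lambda>\<epsilon>::real.
       LINT y:(- ball x \<epsilon>)|lebesgue. (u x - u y) / norm (x - y) powr (real DIM('a) + \<alpha>))"

definition L_space :: "real \<Rightarrow> ('a::euclidean_space \<Rightarrow> real) set" where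
  "L_space \<alpha> = {u. u \<in> borel_measurable lebesgue \<and>
     integrable lebesgue (\<lambda>x. \<bar>u x\<bar> / (1 + norm x powr (real DIM('a) + \<alpha>)))}"

text \<open>Continuity of the gradient is implied by the local Lipschitz condition.\<close>

definition C11_loc :: "('a::euclidean_space \<Rightarrow> real) set" where
  "C11_loc = {u. \<exists>G::'a \<Rightarrow> 'a. (\<forall>x. GDERIV u x :> G x) \<and>
     (\<forall>x. \<exists>r>0. \<exists>L. L-lipschitz_on (ball x r) G)}"

text \<open>Derivatives are taken within \<open>S\<close>, hence are one-sided at boundary points.\<close>

definition C1_on ::
    "('a::real_normed_vector \<Rightarrow> 'b::real_normed_vector) \<Rightarrow> 'a set \<Rightarrow> bool" where
  "C1_on f S \<longleftrightarrow> (\<exists>f'::'a \<Rightarrow> 'a \<Rightarrow>\<^sub>L 'b.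
     (\<forall>x\<in>S. (f has_derivative blinfun_apply (f' x)) (at x within S)) \<and> continuous_on S f')"

definition partial1 :: "(real \<Rightarrow> real \<Rightarrow> real) \<Rightarrow> real \<Rightarrow> real \<Rightarrow> real" where
  "partial1 f s t = deriv (\<lambda>x. f x t) s"

definition partial2 :: "(real \<Rightarrow> real \<Rightarrow> real) \<Rightarrow> real \<Rightarrow> real \<Rightarrow> real" where
  "partial2 f s t = deriv (\<lambda>y. f s y) t"

text \<open>The relation \<open>\<lesssim>\<close> is an inequality with constant \<open>1\<close> near the limit, not one up to
  a multiplicative constant.\<close>

definition lesssim_infinity ::
    "('a::real_normed_vector \<Rightarrow> real) \<Rightarrow> ('a \<Rightarrow> real) \<Rightarrow> bool" where
  "lesssim_infinity A B \<longleftrightarrow> (\<exists>R>0. \<forall>x. norm x > R \<longrightarrow> A x \<le> B x)"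

definition lesssim_origin ::
    "(real \<Rightarrow> real \<Rightarrow> real) \<Rightarrow> (real \<Rightarrow> real \<Rightarrow> real) \<Rightarrow> bool" where
  "lesssim_origin A B \<longleftrightarrow>
     (\<exists>\<delta>>0. \<forall>s t. s > 0 \<longrightarrow> t > 0 \<longrightarrow> s + t < \<delta> \<longrightarrow> A s t \<le> B s t)"

definition radially_symmetric_about ::
    "('a::real_normed_vector \<Rightarrow> real) \<Rightarrow> 'a \<Rightarrow> bool" where
  "radially_symmetric_about u x0 \<longleftrightarrow> (\<exists>\<phi>::real \<Rightarrow> real. \<forall>x. u x = \<phi> (norm (x - x0)))"

end

theory Submission
  imports Defs
begin

text \<open>
  The proof is the direct method of moving planes. Fix a unit vector \<open>e\<close>, reflect the solution in the
  hyperplane \<open>x \<bullet> e = l\<close>, and let \<open>w\<close> and \<open>z\<close> be the differences between the reflected and the original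
  functions \<open>u\<close> and \<open>v\<close>. On the half-space \<open>x \<bullet> e < l\<close>, a negative minimum of \<open>w\<close> at distance \<open>d\<close> from
  the hyperplane forces the fractional Laplacian of \<open>w\<close> to be at most a constant times \<open>d powr - \<alpha> * w\<close>
  (\<open>frac_laplacian_at_antisymmetric_minimum\<close>): folding the integral along the hyperplane leaves an integrand
  without a positive part.

  By the equation, the fractional Laplacian of \<open>w\<close> is a difference of values of \<open>f\<close>. Since \<open>f\<close> increases
  in its second argument, this difference is bounded below by a linear expression in \<open>w\<close> and the negative
  part of \<open>z\<close>, whose coefficients are upper bounds of the partial derivatives of \<open>f\<close>. These
  coefficients are small compared with \<open>d powr - \<alpha>\<close> in two regions: close to the hyperplane, where
  \<open>d powr - \<alpha>\<close> is large, and far from the origin, where the decay of \<open>u\<close> and \<open>v\<close> and the condition on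
  the exponents make the coefficients \<open>o (norm x powr - \<alpha>)\<close>. If the minima of \<open>w\<close> and \<open>z\<close> lie in these
  regions, the depth of each is at most half the depth of the other
  (\<open>antisymmetric_minimum_dominated\<close>), so both functions are nonnegative.

  For very negative \<open>l\<close> the whole half-space is far from the origin, and the differences are nonnegative. The
  plane is then moved until this fails. At the critical position, if the differences were positive, compactness
  would confine negative values for slightly larger \<open>l\<close> to the two regions, and the plane could be moved
  on. So one of the differences has a zero, and by the strong maximum principle
  (\<open>frac_laplacian_at_interior_zero\<close>) and the strict monotonicity of \<open>f\<close> and \<open>g\<close> both vanish
  identically. Thus \<open>u\<close> and \<open>v\<close> are symmetric about some hyperplane in every direction. All these
  hyperplanes pass through one point, since \<open>u\<close> would otherwise be periodic in some direction, and the
  reflections in them act transitively on the spheres around that point.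

  The operator is defined as a limit of truncated integrals, whose existence rests on the cancellation
  of first-order terms under \<open>y \<mapsto> 2 *\<^sub>R x - y\<close> (\<open>truncated_laplacian_convergent\<close>). Both this
  substitution and the folding use that Lebesgue measure is invariant under reflections.
\<close>

section \<open>Invariance of Lebesgue measure under reflections\<close>

text \<open>By the Vitali covering theorem an open set is, up to a null set, a countable disjoint union of
balls. An isometry maps these balls to disjoint balls of the same radii, and it maps null sets to
null sets because it is Lipschitz.\<close>

lemma emeasure_involutive_isometry_image_le:
  fixes T :: "'a::euclidean_space \<Rightarrow> 'a"
  assumes iso: "\<And>x y. dist (T x) (T y) = dist x y" and inv: "\<And>x. T (T x) = x"
    and U: "open U"
  shows "emeasure lebesgue (T ` U) \<le> emeasure lebesgue U"
proof -
  define K where "K = {i::'a \<times> real. 0 < snd i \<and> ball (fst i) (snd i) \<subseteq> U}"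
  have ex: "\<exists>i. i \<in> K \<and> x \<in> ball (fst i) (snd i) \<and> snd i < d" if "x \<in> U" "0 < d" for x d
  proof -
    obtain e where "e > 0" "ball x e \<subseteq> U"
      using U \<open>x \<in> U\<close> open_contains_ball by blast
    then have "(x, min e (d/2)) \<in> K" "x \<in> ball x (min e (d/2))" "min e (d/2) < d"
      using that unfolding K_def by (auto simp: subset_iff)
    then show ?thesis by (intro exI[of _ "(x, min e (d/2))"]) auto
  qed
  obtain I where I: "countable I" "I \<subseteq> K"
     "pairwise (\<lambda>i j. disjnt (ball (fst i) (snd i)) (ball (fst j) (snd j))) I"
     "negligible (U - (\<Union>i\<in>I. ball (fst i) (snd i)))"
    using Vitali_covering_theorem_balls[of U K fst snd] ex by blast
  let ?B = "\<lambda>i. ball (fst i) (snd i)" and ?N = "U - (\<Union>i\<in>I. ball (fst i) (snd i))"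
  have image_ball: "T ` ball c r = ball (T c) r" for c r
  proof (intro equalityI subsetI)
    fix y assume "y \<in> ball (T c) r"
    then have "T y \<in> ball c r" using iso[of "T c" y] inv by auto
    then show "y \<in> T ` ball c r" using inv[of y] by (metis imageI)
  qed (use iso in auto)
  have disj: "disjoint_family_on ?B I"
    using I(3) unfolding disjoint_family_on_def pairwise_def disjnt_def by blast
  have "inj T" using inv by (metis injI)
  then have disjT: "disjoint_family_on (\<lambda>i. T ` ?B i) I"
    using disj unfolding disjoint_family_on_def by (simp add: image_Int[symmetric])
  have negT: "negligible (T ` ?N)"
  proof (rule negligible_locally_Lipschitz_image[OF order_refl I(4)])
    fix x
    show "\<exists>V B. open V \<and> x \<in> V \<and> (\<forall>y \<in> ?N \<inter> V. norm (T y - T x) \<le> B * norm (y - x))"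
      using iso by (intro exI[of _ UNIV] exI[of _ 1]) (simp add: dist_norm[symmetric])
  qed
  have same: "emeasure lebesgue (T ` ?B i) = emeasure lebesgue (?B i)" if "i \<in> I" for i
    using I(2) that unfolding image_ball K_def
    by (auto simp: emeasure_ball dest!: subsetD)
  have "U = (\<Union>i\<in>I. ?B i) \<union> ?N" using I(2) unfolding K_def by auto
  then have "T ` U = (\<Union>i\<in>I. T ` ?B i) \<union> T ` ?N" by (metis image_UN image_Un)
  moreover have meas: "T ` ?B i \<in> sets lebesgue" for i unfolding image_ball by auto
  ultimately have "emeasure lebesgue (T ` U)
      \<le> emeasure lebesgue (\<Union>i\<in>I. T ` ?B i) + emeasure lebesgue (T ` ?N)"
    using negligible_imp_sets[OF negT] I(1)
    by (simp only:) (intro emeasure_subadditive sets.countable_UN', auto)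
  also have "emeasure lebesgue (T ` ?N) = 0"
    using negT negligible_iff_emeasure0 negligible_imp_sets by blast
  also have "emeasure lebesgue (\<Union>i\<in>I. T ` ?B i) = emeasure lebesgue (\<Union>i\<in>I. ?B i)"
    using meas same by (subst (1 2) emeasure_UN_countable)
      (auto simp: I(1) disj disjT intro!: nn_integral_cong)
  also have "\<dots> + 0 \<le> emeasure lebesgue U"
  proof -
    have "(\<Union>i\<in>I. ?B i) \<subseteq> U" using I(2) unfolding K_def by auto
    moreover have "U \<in> sets lebesgue" using U by simp
    ultimately show ?thesis unfolding add_0_right by (rule emeasure_mono)
  qed
  finally show ?thesis .
qed

text \<open>Lebesgue measure is determined by its values on boxes. The previous estimate, applied to a box and
to the image of that box, gives both inequalities. Reflections in hyperplanes and in points are the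
isometries of interest, and being involutions they need no separate inverse.\<close>

lemma distr_lborel_involutive_isometry:
  fixes T :: "'a::euclidean_space \<Rightarrow> 'a"
  assumes iso: "\<And>x y. dist (T x) (T y) = dist x y" and inv: "\<And>x. T (T x) = x"
  shows "distr lborel borel T = lborel"
proof (rule sym, rule lborel_eqI)
  have cont: "continuous_on UNIV T"
    unfolding continuous_on_iff by (metis iso)
  then have [measurable]: "T \<in> borel_measurable borel" by (rule borel_measurable_continuous_onI)
  have vim: "T -` U = T ` U" for U
    using inv by (auto intro: rev_image_eqI)
  fix l u :: 'a assume lu: "\<And>b. b \<in> Basis \<Longrightarrow> l \<bullet> b \<le> u \<bullet> b"
  have op: "open (T ` box l u)"
    using open_vimage[OF open_box cont] unfolding vim .
  have "emeasure lebesgue (T ` box l u) = emeasure lebesgue (box l u)"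
  proof (rule antisym)
    have "T ` T ` box l u = box l u" using inv by (auto simp: image_image)
    then show "emeasure lebesgue (box l u) \<le> emeasure lebesgue (T ` box l u)"
      using emeasure_involutive_isometry_image_le[OF iso inv op] by simp
  qed (rule emeasure_involutive_isometry_image_le[OF iso inv open_box])
  then show "emeasure (distr lborel borel T) (box l u) = (\<Prod>b\<in>Basis. (u - l) \<bullet> b)"
    using lu op by (simp add: emeasure_distr vim)
qed simp

lemma integral_involutive_isometry:
  fixes T :: "'a::euclidean_space \<Rightarrow> 'a" and F :: "'a \<Rightarrow> real"
  assumes iso: "\<And>x y. dist (T x) (T y) = dist x y" and inv: "\<And>x. T (T x) = x"
    and F: "F \<in> borel_measurable borel"
  shows "(LINT y|lborel. F (T y)) = (LINT y|lborel. F y)"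
    and "integrable lborel (\<lambda>y. F (T y)) \<longleftrightarrow> integrable lborel F"
proof -
  have "continuous_on UNIV T"
    unfolding continuous_on_iff by (metis iso)
  then have T: "T \<in> measurable lborel borel"
    using borel_measurable_continuous_onI by simp
  show "(LINT y|lborel. F (T y)) = (LINT y|lborel. F y)"
    using integral_distr[OF T F] distr_lborel_involutive_isometry[OF iso inv] by simp
  show "integrable lborel (\<lambda>y. F (T y)) \<longleftrightarrow> integrable lborel F"
    using integrable_distr_eq[OF T F] distr_lborel_involutive_isometry[OF iso inv] by simp
qed

section \<open>Integrability of the kernel\<close>

text \<open>A substitute for integration in polar coordinates: a function that is at most \<open>c k\<close> on the
\<open>k\<close>-th of a sequence of sets, each contained in a ball of radius \<open>\<rho> k\<close>, is compared with a series
of multiples of indicators of balls.\<close>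

lemma integrable_dominated_on_balls:
  fixes F :: "'a::euclidean_space \<Rightarrow> real" and c \<rho> :: "nat \<Rightarrow> real"
  assumes F: "F \<in> borel_measurable borel" "\<And>x. 0 \<le> F x"
    and nonneg: "\<And>k. 0 \<le> c k" "\<And>k. 0 \<le> \<rho> k"
    and dom: "\<And>x. F x \<noteq> 0 \<Longrightarrow> \<exists>k. norm x < \<rho> k \<and> F x \<le> c k"
    and sm: "summable (\<lambda>k. c k * \<rho> k ^ DIM('a))"
  shows "integrable lborel F"
proof (rule integrableI_bounded)
  show "F \<in> borel_measurable lborel" using F by simp
  let ?w = "unit_ball_vol (DIM('a))"
  have le: "ennreal (norm (F x)) \<le> (\<Sum>k. ennreal (c k) * indicator (ball 0 (\<rho> k)) x)" for x
  proof (cases "F x = 0")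
    case False
    then obtain k where k: "norm x < \<rho> k" "F x \<le> c k" using dom by blast
    have "ennreal (norm (F x)) \<le> ennreal (c k) * indicator (ball 0 (\<rho> k)) x"
      using k F(2) by (auto simp: ennreal_leI)
    also have "\<dots> \<le> (\<Sum>k. ennreal (c k) * indicator (ball 0 (\<rho> k)) x)"
      using sum_le_suminf[of "\<lambda>k. ennreal (c k) * indicator (ball 0 (\<rho> k)) x" "{k}"]
      by (simp del: sum_mult_indicator)
    finally show ?thesis .
  qed simp
  have "(\<integral>\<^sup>+ x. ennreal (norm (F x)) \<partial>lborel)
      \<le> (\<integral>\<^sup>+ x. (\<Sum>k. ennreal (c k) * indicator (ball 0 (\<rho> k)) x) \<partial>(lborel :: 'a measure))"
    by (intro nn_integral_mono le)
  also have "\<dots> = (\<Sum>k. ennreal (c k) * emeasure (lborel :: 'a measure) (ball 0 (\<rho> k)))"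
    by (subst nn_integral_suminf)
      (auto simp: nn_integral_cmult_indicator intro!: borel_measurable_times_ennreal borel_measurable_indicator)
  also have "\<dots> = (\<Sum>k. ennreal (?w * (c k * \<rho> k ^ DIM('a))))"
    using nonneg by (intro suminf_cong) (simp add: emeasure_ball ennreal_mult[symmetric] mult_ac)
  also have "\<dots> = ennreal (\<Sum>k. ?w * (c k * \<rho> k ^ DIM('a)))"
    using nonneg sm by (intro suminf_ennreal2) (auto intro!: summable_mult)
  also have "\<dots> < \<infinity>" by simp
  finally show "(\<integral>\<^sup>+ x. ennreal (norm (F x)) \<partial>lborel) < \<infinity>" .
qed

definition frac_kernel :: "real \<Rightarrow> 'a::euclidean_space \<Rightarrow> real" where
  "frac_kernel \<alpha> h = norm h powr - (real DIM('a) + \<alpha>)"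

lemma frac_kernel_nonneg [simp]: "0 \<le> frac_kernel \<alpha> h"
  by (simp add: frac_kernel_def)

lemma frac_kernel_measurable [measurable]: "frac_kernel \<alpha> \<in> borel_measurable borel"
  unfolding frac_kernel_def by measurable

lemma frac_kernel_decreasing:
  fixes h h' :: "'a::euclidean_space"
  assumes "0 < \<alpha>" "0 < norm h'" "norm h' \<le> norm h"
  shows "frac_kernel \<alpha> h \<le> frac_kernel \<alpha> h'"
  unfolding frac_kernel_def using assms by (intro powr_mono2') auto

text \<open>The \<open>k\<close>-th dyadic annulus \<open>\<epsilon> * 2 ^ k \<le> norm x < \<epsilon> * 2 ^ Suc k\<close> contributes a multiple of
\<open>2 powr (- \<alpha> * k)\<close>, a convergent geometric series.\<close>

lemma integrable_frac_kernel_off_ball: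
  fixes \<alpha> \<epsilon> :: real
  assumes \<alpha>: "0 < \<alpha>" and \<epsilon>: "0 < \<epsilon>"
  shows "integrable lborel (\<lambda>h::'a::euclidean_space. indicator (- ball 0 \<epsilon>) h * frac_kernel \<alpha> h)"
proof (rule integrable_dominated_on_balls
    [where c = "\<lambda>k. (\<epsilon> * 2 ^ k) powr - (real DIM('a) + \<alpha>)" and \<rho> = "\<lambda>k. \<epsilon> * 2 ^ Suc k"])
  show "(\<lambda>h::'a. indicator (- ball 0 \<epsilon>) h * frac_kernel \<alpha> h) \<in> borel_measurable borel"
    by measurable
  fix x :: 'a assume "indicator (- ball 0 \<epsilon>) x * frac_kernel \<alpha> x \<noteq> 0"
  then have x: "\<epsilon> \<le> norm x" by (auto simp: indicator_def split: if_splits)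
  \<comment> \<open>The index of the annulus that contains \<open>x\<close>.\<close>
  define k where "k = (LEAST k. norm x < \<epsilon> * 2 ^ Suc k)"
  have "\<exists>k. norm x < \<epsilon> * 2 ^ Suc k"
  proof -
    obtain n where "norm x / \<epsilon> < 2 ^ n" using real_arch_pow[of 2 "norm x / \<epsilon>"] by auto
    then have "norm x < \<epsilon> * 2 ^ n" using \<epsilon> by (simp add: field_simps)
    also have "\<dots> \<le> \<epsilon> * 2 ^ Suc n" using \<epsilon> by simp
    finally show ?thesis by blast
  qed
  then have k: "norm x < \<epsilon> * 2 ^ Suc k" unfolding k_def by (rule LeastI_ex)
  have "\<epsilon> * 2 ^ k \<le> norm x"
  proof (cases k)
    case (Suc j)
    then have "\<not> norm x < \<epsilon> * 2 ^ Suc j" unfolding k_def using not_less_Least by (metis lessI)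
    then show ?thesis using Suc by simp
  qed (use x in simp)
  then show "\<exists>k. norm x < \<epsilon> * 2 ^ Suc k \<and>
      indicator (- ball 0 \<epsilon>) x * frac_kernel \<alpha> x \<le> (\<epsilon> * 2 ^ k) powr - (real DIM('a) + \<alpha>)"
    using k \<alpha> \<epsilon> by (intro exI[of _ k])
      (auto simp: frac_kernel_def indicator_def intro!: powr_mono2')
next
  have "(\<lambda>k. (\<epsilon> * 2 ^ k) powr - (real DIM('a) + \<alpha>) * (\<epsilon> * 2 ^ Suc k) ^ DIM('a))
      = (\<lambda>k. 2 ^ DIM('a) * \<epsilon> powr - \<alpha> * (2 powr - \<alpha>) ^ k)"
  proof
    fix k
    have "(\<epsilon> * 2 ^ Suc k) ^ DIM('a) = 2 ^ DIM('a) * (\<epsilon> * 2 ^ k) powr real DIM('a)"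
      using \<epsilon> by (simp add: powr_realpow power_mult_distrib)
    then have "(\<epsilon> * 2 ^ k) powr - (real DIM('a) + \<alpha>) * (\<epsilon> * 2 ^ Suc k) ^ DIM('a)
        = 2 ^ DIM('a) * (\<epsilon> * 2 ^ k) powr - \<alpha>"
      by (simp add: powr_add[symmetric])
    also have "(\<epsilon> * 2 ^ k) powr - \<alpha> = \<epsilon> powr - \<alpha> * (2 powr - \<alpha>) ^ k"
      using \<epsilon> by (simp add: powr_mult powr_realpow[symmetric] powr_powr mult.commute)
    finally show "(\<epsilon> * 2 ^ k) powr - (real DIM('a) + \<alpha>) * (\<epsilon> * 2 ^ Suc k) ^ DIM('a)
      = 2 ^ DIM('a) * \<epsilon> powr - \<alpha> * (2 powr - \<alpha>) ^ k" by simp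
  qed
  moreover have "2 powr - \<alpha> < 1" using \<alpha> by (simp add: powr_less_one)
  ultimately show "summable (\<lambda>k. (\<epsilon> * 2 ^ k) powr - (real DIM('a) + \<alpha>) * (\<epsilon> * 2 ^ Suc k) ^ DIM('a))"
    by (simp add: summable_mult summable_geometric)
qed (use \<epsilon> in auto)

text \<open>Here the annuli shrink to the origin, and the \<open>k\<close>-th one contributes a multiple of
\<open>2 powr (- (2 - \<alpha>) * k)\<close>. This is where \<open>\<alpha> < 2\<close> enters.\<close>

lemma integrable_frac_kernel_square_on_ball:
  fixes \<alpha> r :: real
  assumes \<alpha>: "0 < \<alpha>" "\<alpha> < 2" and r: "0 < r"
  shows "integrable lborel
    (\<lambda>h::'a::euclidean_space. indicator (ball 0 r) h * ((norm h)\<^sup>2 * frac_kernel \<alpha> h))"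
proof (rule integrable_dominated_on_balls
    [where c = "\<lambda>k. (r / 2 ^ k)\<^sup>2 * (r / 2 ^ Suc k) powr - (real DIM('a) + \<alpha>)"
       and \<rho> = "\<lambda>k. r / 2 ^ k"])
  show "(\<lambda>h::'a. indicator (ball 0 r) h * ((norm h)\<^sup>2 * frac_kernel \<alpha> h)) \<in> borel_measurable borel"
    by (intro borel_measurable_times borel_measurable_indicator borel_measurable_power
        borel_measurable_norm frac_kernel_measurable) auto
  fix x :: 'a assume "indicator (ball 0 r) x * ((norm x)\<^sup>2 * frac_kernel \<alpha> x) \<noteq> 0"
  then have x: "norm x < r" "0 < norm x" by (auto simp: indicator_def split: if_splits)
  \<comment> \<open>The index of the annulus that contains \<open>x\<close>.\<close>
  define k where "k = (LEAST k. r / 2 ^ Suc k \<le> norm x)"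
  have "\<exists>k. r / 2 ^ Suc k \<le> norm x"
  proof -
    obtain n where "r / norm x < 2 ^ n" using real_arch_pow[of 2 "r / norm x"] by auto
    then have "r / 2 ^ n < norm x" using x by (simp add: field_simps)
    moreover have "r / 2 ^ Suc n \<le> r / 2 ^ n" using r by (simp add: field_simps)
    ultimately show ?thesis by (meson less_le_trans less_imp_le order_trans)
  qed
  then have k: "r / 2 ^ Suc k \<le> norm x" unfolding k_def by (rule LeastI_ex)
  have "norm x < r / 2 ^ k"
  proof (cases k)
    case (Suc j)
    then have "\<not> r / 2 ^ Suc j \<le> norm x" unfolding k_def using not_less_Least by (metis lessI)
    then show ?thesis using Suc by simp
  qed (use x in simp)
  then show "\<exists>k. norm x < r / 2 ^ k \<and> indicator (ball 0 r) x * ((norm x)\<^sup>2 * frac_kernel \<alpha> x)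
      \<le> (r / 2 ^ k)\<^sup>2 * (r / 2 ^ Suc k) powr - (real DIM('a) + \<alpha>)"
    using k \<alpha> r x by (intro exI[of _ k])
      (auto simp: frac_kernel_def indicator_def intro!: powr_mono2' mult_mono power_mono)
next
  have "(\<lambda>k. (r / 2 ^ k)\<^sup>2 * (r / 2 ^ Suc k) powr - (real DIM('a) + \<alpha>) * (r / 2 ^ k) ^ DIM('a))
      = (\<lambda>k. 2 powr (real DIM('a) + \<alpha>) * r powr (2 - \<alpha>) * (2 powr (\<alpha> - 2)) ^ k)"
  proof
    fix k
    have pos: "0 < r / 2 ^ k" using r by simp
    have "(r / 2 ^ Suc k) powr - (real DIM('a) + \<alpha>)
        = (r / 2 ^ k * (1 / 2)) powr - (real DIM('a) + \<alpha>)" by (simp add: mult.commute)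
    also have "\<dots> = (r / 2 ^ k) powr - (real DIM('a) + \<alpha>) * (1 / 2) powr - (real DIM('a) + \<alpha>)"
      by (rule powr_mult) 
    also have "(1 / 2) powr - y = 2 powr y" for y :: real
      by (simp add: powr_divide powr_minus field_simps)
    finally have 1: "(r / 2 ^ Suc k) powr - (real DIM('a) + \<alpha>)
      = 2 powr (real DIM('a) + \<alpha>) * (r / 2 ^ k) powr - (real DIM('a) + \<alpha>)" by simp
    have 2: "(r / 2 ^ k)\<^sup>2 = (r / 2 ^ k) powr 2" "(r / 2 ^ k) ^ DIM('a) = (r / 2 ^ k) powr real DIM('a)"
      using pos by (simp_all add: powr_realpow)
    have "(r / 2 ^ k)\<^sup>2 * (r / 2 ^ Suc k) powr - (real DIM('a) + \<alpha>) * (r / 2 ^ k) ^ DIM('a)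
        = 2 powr (real DIM('a) + \<alpha>) * (r / 2 ^ k) powr (2 - \<alpha>)"
      unfolding 1 2 by (simp add: powr_add[symmetric])
    also have "(r / 2 ^ k) powr (2 - \<alpha>) = r powr (2 - \<alpha>) / (2 ^ k) powr (2 - \<alpha>)"
      by (rule powr_divide)
    also have "(2 ^ k) powr (2 - \<alpha>) = inverse ((2 powr (\<alpha> - 2)) ^ k)"
      by (simp add: powr_realpow[symmetric] powr_powr powr_minus[symmetric] algebra_simps)
    finally show "(r / 2 ^ k)\<^sup>2 * (r / 2 ^ Suc k) powr - (real DIM('a) + \<alpha>) * (r / 2 ^ k) ^ DIM('a)
      = 2 powr (real DIM('a) + \<alpha>) * r powr (2 - \<alpha>) * (2 powr (\<alpha> - 2)) ^ k"
      by (simp add: field_simps)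
  qed
  moreover have "2 powr (\<alpha> - 2) < 1" using \<alpha> by (simp add: powr_less_one)
  ultimately show "summable (\<lambda>k. (r / 2 ^ k)\<^sup>2 * (r / 2 ^ Suc k) powr - (real DIM('a) + \<alpha>)
      * (r / 2 ^ k) ^ DIM('a))"
    by (simp add: summable_mult summable_geometric)
qed (use r in auto)

section \<open>Existence of the principal value\<close>

lemma C11_loc_continuous:
  fixes u :: "'a::euclidean_space \<Rightarrow> real"
  assumes "u \<in> C11_loc"
  shows "continuous_on UNIV u"
proof -
  obtain G where "\<And>x. GDERIV u x :> G x" using assms unfolding C11_loc_def by blast
  then show ?thesis
    unfolding gderiv_def
    by (intro continuous_at_imp_continuous_on ballI) (meson has_derivative_continuous)
qed

text \<open>By the mean value theorem, a Lipschitz gradient bounds the error of the first-order Taylor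
polynomial at \<open>x\<close> by \<open>L * (norm h)\<^sup>2\<close>; the linear terms for \<open>h\<close> and \<open>- h\<close> cancel.\<close>

lemma C11_loc_second_difference:
  fixes u :: "'a::euclidean_space \<Rightarrow> real"
  assumes "u \<in> C11_loc"
  obtains r L where "0 < r" "\<And>h. norm h < r \<Longrightarrow> \<bar>2 * u x - u (x + h) - u (x - h)\<bar> \<le> L * (norm h)\<^sup>2"
proof -
  obtain G where G: "\<And>x. GDERIV u x :> G x" and "\<exists>r>0. \<exists>L. L-lipschitz_on (ball x r) G"
    using assms unfolding C11_loc_def by blast
  then obtain r L where r: "r > 0" and L: "L-lipschitz_on (ball x r) G" by blast
  have taylor: "\<bar>u (x + h) - u x - h \<bullet> G x\<bar> \<le> L * (norm h)\<^sup>2" if h: "norm h < r" for h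
  proof -
    have der: "((\<lambda>t. u (x + t *\<^sub>R h)) has_real_derivative (h \<bullet> G (x + t *\<^sub>R h))) (at t)" for t
    proof -
      have "((\<lambda>t. x + t *\<^sub>R h) has_derivative (\<lambda>t. t *\<^sub>R h)) (at t)"
        by (auto intro!: derivative_eq_intros)
      from has_derivative_compose[OF this G[unfolded gderiv_def]]
      show ?thesis unfolding has_field_derivative_def
        by (rule has_derivative_eq_rhs) (auto simp: mult.commute)
    qed
    have "\<exists>z>0. z < 1 \<and> u (x + 1 *\<^sub>R h) - u (x + 0 *\<^sub>R h) = (1 - 0) * (h \<bullet> G (x + z *\<^sub>R h))"
      by (rule MVT2) (use der in auto)
    then obtain z where z: "0 < z" "z < 1" "u (x + h) - u x = h \<bullet> G (x + z *\<^sub>R h)" by auto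
    have zh: "norm (z *\<^sub>R h) \<le> norm h" using z by (simp add: mult_left_le_one_le)
    then have "norm (G (x + z *\<^sub>R h) - G x) \<le> L * norm (z *\<^sub>R h)"
      using lipschitz_onD[OF L, of "x + z *\<^sub>R h" x] r h by (simp add: dist_norm)
    also have "\<dots> \<le> L * norm h"
      using zh lipschitz_on_nonneg[OF L] by (rule mult_left_mono)
    finally have G': "norm (G (x + z *\<^sub>R h) - G x) \<le> L * norm h" .
    have "\<bar>u (x + h) - u x - h \<bullet> G x\<bar> = \<bar>h \<bullet> (G (x + z *\<^sub>R h) - G x)\<bar>"
      using z by (simp add: inner_diff_right)
    also have "\<dots> \<le> norm h * norm (G (x + z *\<^sub>R h) - G x)" by (rule Cauchy_Schwarz_ineq2)
    also have "\<dots> \<le> norm h * (L * norm h)" using G' by (intro mult_left_mono) auto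
    finally show ?thesis by (simp add: power2_eq_square mult_ac)
  qed
  have "\<bar>2 * u x - u (x + h) - u (x - h)\<bar> \<le> (2 * L) * (norm h)\<^sup>2" if "norm h < r" for h
    using taylor[of h] taylor[of "- h"] that by simp
  then show thesis using r that by blast
qed

text \<open>The integral over Borel rather than Lebesgue measure has the same value for the Borel functions at
hand, and both substitution and the integrability criteria above are stated for it.\<close>

definition truncated_laplacian ::
    "real \<Rightarrow> ('a::euclidean_space \<Rightarrow> real) \<Rightarrow> 'a \<Rightarrow> real \<Rightarrow> real" where
  "truncated_laplacian \<alpha> u x \<epsilon> =
     (LINT y|lborel. indicator (- ball x \<epsilon>) y * ((u x - u y) * frac_kernel \<alpha> (x - y)))"

lemma frac_kernel_shift_measurable [measurable]:
  "(\<lambda>y. frac_kernel \<alpha> (x - y)) \<in> borel_measurable borel"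
  by (rule measurable_compose[OF _ frac_kernel_measurable]) measurable

lemma integrable_frac_kernel_off_ball_shift:
  fixes x :: "'a::euclidean_space"
  assumes \<alpha>: "0 < \<alpha>" and \<epsilon>: "0 < \<epsilon>"
  shows "integrable lborel (\<lambda>y. indicator (- ball x \<epsilon>) y * frac_kernel \<alpha> (x - y))"
proof -
  have "integrable lborel (\<lambda>y. indicator (- ball (0::'a) \<epsilon>) (x - y) * frac_kernel \<alpha> (x - y))"
    using integrable_frac_kernel_off_ball[OF \<alpha> \<epsilon>, where 'a = 'a]
    by (subst integral_involutive_isometry(2)[where T = "\<lambda>y. x - y"]) (auto simp: dist_norm norm_minus_commute)
  moreover have "indicator (- ball (0::'a) \<epsilon>) (x - y) = (indicator (- ball x \<epsilon>) y :: real)" for y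
    by (simp add: indicator_def dist_norm norm_minus_commute)
  ultimately show ?thesis by simp
qed

text \<open>Off a ball around \<open>x\<close>, the weight \<open>1 + norm y powr N\<close> of \<open>L_space\<close> is at most a constant times
\<open>norm (x - y) powr N\<close>, where \<open>N\<close> is the exponent of the kernel.\<close>

lemma L_space_integrable_off_ball:
  fixes u :: "'a::euclidean_space \<Rightarrow> real"
  assumes u: "u \<in> L_space \<alpha>" and meas: "u \<in> borel_measurable borel" and \<alpha>: "0 < \<alpha>" and \<epsilon>: "0 < \<epsilon>"
  shows "integrable lborel (\<lambda>y. indicator (- ball x \<epsilon>) y * (u y * frac_kernel \<alpha> (x - y)))"
proof -
  define N where "N = real DIM('a) + \<alpha>"
  have N: "0 < N" using \<alpha> unfolding N_def by simp
  define c where "c = \<epsilon> powr - N + (norm x / \<epsilon> + 1) powr N"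
  have "integrable lebesgue (\<lambda>y. \<bar>u y\<bar> / (1 + norm y powr N))"
    using u unfolding L_space_def N_def by simp
  then have "integrable lborel (\<lambda>y. \<bar>u y\<bar> / (1 + norm y powr N))"
    using meas by (subst (asm) integrable_completion) auto
  then have int: "integrable lborel (\<lambda>y. c * (\<bar>u y\<bar> / (1 + norm y powr N)))"
    by (rule integrable_mult_right)
  have "\<bar>indicator (- ball x \<epsilon>) y * (u y * frac_kernel \<alpha> (x - y))\<bar>
      \<le> \<bar>c * (\<bar>u y\<bar> / (1 + norm y powr N))\<bar>" for y
  proof (cases "y \<in> ball x \<epsilon>")
    case True
    then show ?thesis by simp
  next
    case False
    define \<rho> where "\<rho> = norm (x - y)"
    have \<rho>: "\<epsilon> \<le> \<rho>" using False by (simp add: \<rho>_def dist_norm)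
    have "norm y \<le> norm x + \<rho>" unfolding \<rho>_def by (metis norm_minus_commute norm_triangle_sub)
    also have "\<dots> \<le> norm x * (\<rho> / \<epsilon>) + \<rho>"
    proof -
      have "norm x * 1 \<le> norm x * (\<rho> / \<epsilon>)" using \<rho> \<epsilon> by (intro mult_left_mono) auto
      then show ?thesis by simp
    qed
    finally have "norm y \<le> (norm x / \<epsilon> + 1) * \<rho>" by (simp add: field_simps)
    then have "norm y powr N \<le> ((norm x / \<epsilon> + 1) * \<rho>) powr N"
      using N by (intro powr_mono2) auto
    also have "\<dots> = (norm x / \<epsilon> + 1) powr N * \<rho> powr N"
      by (rule powr_mult)
    finally have 1: "norm y powr N \<le> (norm x / \<epsilon> + 1) powr N * \<rho> powr N" .
    have "\<epsilon> powr N \<le> \<rho> powr N" using \<epsilon> \<rho> N by (intro powr_mono2) auto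
    then have 2: "1 \<le> \<epsilon> powr - N * \<rho> powr N" using \<epsilon> by (simp add: powr_minus field_simps)
    have "1 + norm y powr N \<le> c * \<rho> powr N"
      unfolding c_def using 1 2 by (simp add: distrib_right)
    moreover have "0 < \<rho> powr N" "0 < 1 + norm y powr N" using \<rho> \<epsilon> by (auto intro: add_pos_nonneg)
    ultimately have "1 / \<rho> powr N \<le> c / (1 + norm y powr N)" by (simp add: field_simps)
    then have "\<rho> powr - N \<le> c / (1 + norm y powr N)" by (simp add: powr_minus_divide)
    then have "\<bar>u y\<bar> * \<rho> powr - N \<le> \<bar>u y\<bar> * (c / (1 + norm y powr N))" by (rule mult_left_mono) simp
    then have "\<bar>u y\<bar> * frac_kernel \<alpha> (x - y) \<le> \<bar>u y\<bar> * (c / (1 + norm y powr N))"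
      unfolding frac_kernel_def \<rho>_def N_def .
    then show ?thesis using False
      by (intro order_trans[OF _ abs_ge_self]) (simp add: abs_mult mult_ac)
  qed
  then show ?thesis using meas
    by (intro Bochner_Integration.integrable_bound[OF int]) auto
qed

lemma truncated_laplacian_integrable:
  fixes u :: "'a::euclidean_space \<Rightarrow> real"
  assumes "u \<in> L_space \<alpha>" "u \<in> borel_measurable borel" "0 < \<alpha>" "0 < \<epsilon>"
  shows "integrable lborel (\<lambda>y. indicator (- ball x \<epsilon>) y * ((c - u y) * frac_kernel \<alpha> (x - y)))"
proof -
  have "integrable lborel (\<lambda>y. c * (indicator (- ball x \<epsilon>) y * frac_kernel \<alpha> (x - y))
      - indicator (- ball x \<epsilon>) y * (u y * frac_kernel \<alpha> (x - y)))"
    using L_space_integrable_off_ball[OF assms] integrable_frac_kernel_off_ball_shift[OF assms(3,4)]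
    by (intro Bochner_Integration.integrable_diff integrable_mult_right)
  then show ?thesis by (simp add: algebra_simps)
qed

text \<open>Averaging the integrand with its image under the point reflection \<open>y \<mapsto> 2 *\<^sub>R x - y\<close>, which fixes the
domain and the kernel, replaces the first difference of \<open>u\<close> by the second difference.\<close>

lemma truncated_laplacian_symmetrised:
  fixes u :: "'a::euclidean_space \<Rightarrow> real" and x :: 'a
  assumes u: "u \<in> L_space \<alpha>" "u \<in> borel_measurable borel" and \<alpha>: "0 < \<alpha>" and \<epsilon>: "0 < \<epsilon>"
  defines "H \<equiv> \<lambda>y. (2 * u x - u y - u (2 *\<^sub>R x - y)) * frac_kernel \<alpha> (x - y)"
  shows "integrable lborel (\<lambda>y. indicator (- ball x \<epsilon>) y * H y)"
    and "truncated_laplacian \<alpha> u x \<epsilon> = (LINT y|lborel. indicator (- ball x \<epsilon>) y * H y) / 2"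
proof -
  let ?F = "\<lambda>y. indicator (- ball x \<epsilon>) y * ((u x - u y) * frac_kernel \<alpha> (x - y))"
  let ?T = "\<lambda>y. 2 *\<^sub>R x - y"
  have int: "integrable lborel ?F" by (rule truncated_laplacian_integrable[OF u \<alpha> \<epsilon>])
  have isoT: "dist (?T y) (?T z) = dist y z" "?T (?T y) = y" for y z
    by (simp_all add: dist_norm norm_minus_commute)
  have Fm: "?F \<in> borel_measurable borel" using int by auto
  have intT: "integrable lborel (\<lambda>y. ?F (?T y))"
    using integral_involutive_isometry(2)[OF isoT Fm] int by simp
  have "norm (x - ?T y) = norm (x - y)" for y
  proof -
    have "x - ?T y = - (x - y)" by (simp add: scaleR_2)
    then show ?thesis by (simp only: norm_minus_cancel)
  qed
  then have kernel_T: "frac_kernel \<alpha> (x - ?T y) = frac_kernel \<alpha> (x - y)"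
    and indicator_T: "indicator (- ball x \<epsilon>) (?T y) = (indicator (- ball x \<epsilon>) y :: real)" for y
    by (simp_all add: frac_kernel_def indicator_def dist_norm)
  have sum: "?F y + ?F (?T y) = indicator (- ball x \<epsilon>) y * H y" for y
    unfolding H_def kernel_T indicator_T by (simp add: algebra_simps)
  show "integrable lborel (\<lambda>y. indicator (- ball x \<epsilon>) y * H y)"
    using Bochner_Integration.integrable_add[OF int intT] unfolding sum .
  have "2 * truncated_laplacian \<alpha> u x \<epsilon> = (LINT y|lborel. ?F y) + (LINT y|lborel. ?F (?T y))"
    unfolding truncated_laplacian_def integral_involutive_isometry(1)[OF isoT Fm] by simp
  also have "\<dots> = (LINT y|lborel. indicator (- ball x \<epsilon>) y * H y)"
    using Bochner_Integration.integral_add[OF int intT] unfolding sum by simp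
  finally show "truncated_laplacian \<alpha> u x \<epsilon> = (LINT y|lborel. indicator (- ball x \<epsilon>) y * H y) / 2"
    by simp
qed

text \<open>The symmetrised integrand is integrable on the whole space: near \<open>x\<close> the quadratic bound on second
differences compensates the singularity of the kernel. So dominated convergence applies.\<close>

lemma truncated_laplacian_convergent:
  fixes u :: "'a::euclidean_space \<Rightarrow> real"
  assumes u: "u \<in> L_space \<alpha>" "u \<in> C11_loc" and \<alpha>: "0 < \<alpha>" "\<alpha> < 2"
  shows "\<exists>l. (truncated_laplacian \<alpha> u x \<longlongrightarrow> l) (at_right 0)"
proof -
  define H where "H y = (2 * u x - u y - u (2 *\<^sub>R x - y)) * frac_kernel \<alpha> (x - y)" for y
  have meas: "u \<in> borel_measurable borel"
    using C11_loc_continuous[OF u(2)] by (rule borel_measurable_continuous_onI)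
  note sym = truncated_laplacian_symmetrised[OF u(1) meas \<alpha>(1), where x = x, folded H_def]
  have Hm: "H \<in> borel_measurable borel" unfolding H_def
    by (intro borel_measurable_times borel_measurable_diff frac_kernel_shift_measurable
        measurable_compose[OF _ meas]) auto
  obtain r L where r: "0 < r" and
      L: "\<And>h. norm h < r \<Longrightarrow> \<bar>2 * u x - u (x + h) - u (x - h)\<bar> \<le> L * (norm h)\<^sup>2"
    using C11_loc_second_difference[OF u(2), where x = x] by blast
  have Hint: "integrable lborel H"
  proof -
    let ?Q = "\<lambda>h::'a. indicator (ball 0 r) h * ((norm h)\<^sup>2 * frac_kernel \<alpha> h)"
    have int: "integrable lborel (\<lambda>y. L * ?Q (x - y))"
      using integrable_frac_kernel_square_on_ball[OF \<alpha> r, where 'a = 'a]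
      by (intro integrable_mult_right, subst integral_involutive_isometry(2)[where F = ?Q])
        (auto simp: dist_norm norm_minus_commute)
    have "\<bar>indicator (ball x r) y * H y\<bar> \<le> \<bar>L * ?Q (x - y)\<bar>" for y
    proof (cases "y \<in> ball x r")
      case True
      then have "\<bar>2 * u x - u y - u (2 *\<^sub>R x - y)\<bar> \<le> L * (norm (x - y))\<^sup>2"
        using L[of "y - x"] by (simp add: dist_norm norm_minus_commute scaleR_2 algebra_simps)
      moreover have "x - y \<in> ball 0 r" using True by (simp add: dist_norm norm_minus_commute)
      moreover from calculation(1) have "\<bar>2 * u x - u y - u (2 *\<^sub>R x - y)\<bar> * frac_kernel \<alpha> (x - y)
          \<le> L * (norm (x - y))\<^sup>2 * frac_kernel \<alpha> (x - y)"
        by (rule mult_right_mono) simp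
      ultimately show ?thesis using True
        by (intro order_trans[OF _ abs_ge_self]) (simp add: H_def abs_mult dist_norm mult_ac)
    qed simp
    then have "integrable lborel (\<lambda>y. indicator (ball x r) y * H y)"
      using Hm by (intro Bochner_Integration.integrable_bound[OF int])
        (auto intro!: borel_measurable_times borel_measurable_indicator)
    from Bochner_Integration.integrable_add[OF this sym(1)[OF r]] show ?thesis
      by (rule Bochner_Integration.integrable_cong[THEN iffD1, rotated 2]) (auto simp: indicator_def)
  qed
  have "(truncated_laplacian \<alpha> u x \<longlongrightarrow> (LINT y|lborel. H y) / 2) (at_right 0)"
  proof (rule tendsto_at_right_sequentially[of 0 1])
    fix S :: "nat \<Rightarrow> real"
    assume S: "\<And>n. 0 < S n" "S \<longlonglongrightarrow> 0"
    have "(\<lambda>n. LINT y|lborel. indicator (- ball x (S n)) y * H y) \<longlonglongrightarrow> (LINT y|lborel. H y)"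
    proof (rule integral_dominated_convergence[where w = "\<lambda>y. \<bar>H y\<bar>"])
      show "AE y in lborel. (\<lambda>n. indicator (- ball x (S n)) y * H y) \<longlonglongrightarrow> H y"
      proof (rule AE_I2)
        fix y :: 'a
        show "(\<lambda>n. indicator (- ball x (S n)) y * H y) \<longlonglongrightarrow> H y"
        proof (cases "y = x")
          case True
          \<comment> \<open>The kernel is zero at the origin, because \<open>0 powr _ = 0\<close>.\<close>
          then have "H y = 0" by (simp add: H_def frac_kernel_def)
          then show ?thesis by simp
        next
          case False
          then have "\<forall>\<^sub>F n in sequentially. S n < dist x y"
            using S(2) by (intro order_tendstoD(2)) auto
          then have "\<forall>\<^sub>F n in sequentially. indicator (- ball x (S n)) y * H y = H y"
            by eventually_elim simp
          then show ?thesis by (rule tendsto_eventually)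
        qed
      qed
    qed (use Hm Hint in \<open>auto simp: abs_mult indicator_def\<close>)
    then show "(\<lambda>n. truncated_laplacian \<alpha> u x (S n)) \<longlonglongrightarrow> (LINT y|lborel. H y) / 2"
      unfolding sym(2)[OF S(1)] by (intro tendsto_divide) auto
  qed simp
  then show ?thesis by blast
qed

text \<open>The definition of the operator by \<open>Lim\<close> carries information only through the existence of the limit,
and this lemma makes it usable: every later statement about \<open>frac_laplacian\<close> passes through it.\<close>

lemma frac_laplacian_limit:
  fixes u :: "'a::euclidean_space \<Rightarrow> real"
  assumes u: "u \<in> L_space \<alpha> \<inter> C11_loc" and \<alpha>: "0 < \<alpha>" "\<alpha> < 2"
  shows "((\<lambda>\<epsilon>. C * truncated_laplacian \<alpha> u x \<epsilon>) \<longlongrightarrow> frac_laplacian C \<alpha> u x) (at_right 0)"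
proof -
  have meas: "u \<in> borel_measurable borel"
    using C11_loc_continuous u by (auto intro: borel_measurable_continuous_onI)
  have "(LINT y:(- ball x \<epsilon>)|lebesgue. (u x - u y) / norm (x - y) powr (real DIM('a) + \<alpha>))
      = truncated_laplacian \<alpha> u x \<epsilon>" for \<epsilon>
  proof -
    have "indicator (- ball x \<epsilon>) y *\<^sub>R ((u x - u y) / norm (x - y) powr (real DIM('a) + \<alpha>))
      = indicator (- ball x \<epsilon>) y * ((u x - u y) * frac_kernel \<alpha> (x - y))" for y
      unfolding frac_kernel_def powr_minus_divide by simp
    moreover have "(\<lambda>y. indicator (- ball x \<epsilon>) y * ((u x - u y) * frac_kernel \<alpha> (x - y)))
        \<in> borel_measurable lborel" using meas by simp
    ultimately show ?thesis unfolding truncated_laplacian_def set_lebesgue_integral_def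
      by (simp only:) (rule integral_completion)
  qed
  moreover obtain l where l: "(truncated_laplacian \<alpha> u x \<longlongrightarrow> l) (at_right 0)"
    using truncated_laplacian_convergent u \<alpha> by blast
  ultimately have "frac_laplacian C \<alpha> u x = C * l"
    unfolding frac_laplacian_def by (simp add: tendsto_Lim)
  then show ?thesis using l by (auto intro!: tendsto_intros)
qed

section \<open>Reflections in hyperplanes\<close>

text \<open>The reflection in the hyperplane of all \<open>x\<close> with \<open>x \<bullet> e = l\<close>, provided that \<open>e\<close> is a unit vector.\<close>

definition hyperplane_reflection :: "'a::euclidean_space \<Rightarrow> real \<Rightarrow> 'a \<Rightarrow> 'a" where
  "hyperplane_reflection e l x = x + (2 * (l - x \<bullet> e)) *\<^sub>R e"

context
  fixes e :: "'a::euclidean_space"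
  assumes e: "norm e = 1"
begin

lemma inner_unit: "e \<bullet> e = 1"
  using e by (simp add: dot_square_norm)

lemma hyperplane_reflection_inner:
  "hyperplane_reflection e l x \<bullet> e = 2 * l - x \<bullet> e"
  by (simp add: hyperplane_reflection_def inner_add_left inner_unit)

lemma hyperplane_reflection_involution:
  "hyperplane_reflection e l (hyperplane_reflection e l x) = x"
  unfolding hyperplane_reflection_def
  by (simp add: inner_add_left inner_unit scaleR_add_left[symmetric])

text \<open>All distance properties of the reflection follow from this identity: the correction term is
symmetric in the two points, and it is positive exactly when they lie strictly on the same side.\<close>

lemma norm_diff_hyperplane_reflection_sq:
  "(norm (x - hyperplane_reflection e l y))\<^sup>2 = (norm (x - y))\<^sup>2 + 4 * (l - x \<bullet> e) * (l - y \<bullet> e)"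
proof -
  define t where "t = 2 * (l - y \<bullet> e)"
  have "x - hyperplane_reflection e l y = (x - y) - t *\<^sub>R e"
    by (simp add: hyperplane_reflection_def t_def)
  then have "(norm (x - hyperplane_reflection e l y))\<^sup>2 = (norm ((x - y) - t *\<^sub>R e))\<^sup>2"
    by (simp only:)
  also have "\<dots> = (norm (x - y))\<^sup>2 - 2 * t * (x \<bullet> e - y \<bullet> e) + t * t"
    by (simp add: power2_norm_eq_inner inner_diff_left inner_diff_right inner_unit
        inner_commute algebra_simps)
  finally have "(norm (x - hyperplane_reflection e l y))\<^sup>2
      = (norm (x - y))\<^sup>2 - 2 * t * (x \<bullet> e - y \<bullet> e) + t * t" .
  then show ?thesis by (simp add: t_def algebra_simps)
qed

lemma dist_hyperplane_reflection:
  "dist (hyperplane_reflection e l x) (hyperplane_reflection e l y) = dist x y"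
proof -
  have "(norm (hyperplane_reflection e l x - hyperplane_reflection e l y))\<^sup>2 = (norm (x - y))\<^sup>2"
    unfolding norm_diff_hyperplane_reflection_sq
    by (subst norm_minus_commute)
      (simp add: norm_diff_hyperplane_reflection_sq hyperplane_reflection_inner norm_minus_commute algebra_simps)
  then show ?thesis by (simp add: dist_norm)
qed

lemma dist_hyperplane_reflection_swap:
  "dist (hyperplane_reflection e l x) y = dist x (hyperplane_reflection e l y)"
  by (metis dist_hyperplane_reflection hyperplane_reflection_involution)

lemma dist_self_hyperplane_reflection:
  assumes "x \<bullet> e \<le> l"
  shows "dist x (hyperplane_reflection e l x) = 2 * (l - x \<bullet> e)"
  using assms e by (simp add: hyperplane_reflection_def dist_norm)

lemma dist_less_dist_hyperplane_reflection:
  assumes "x \<bullet> e < l" "y \<bullet> e < l"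
  shows "dist x y < dist x (hyperplane_reflection e l y)"
proof -
  have "(norm (x - y))\<^sup>2 < (norm (x - hyperplane_reflection e l y))\<^sup>2"
    unfolding norm_diff_hyperplane_reflection_sq using assms by simp
  then show ?thesis by (simp add: dist_norm power_less_imp_less_base)
qed

end

lemma hyperplane_reflection_continuous [continuous_intros]:
  assumes "continuous_on S l" "continuous_on S x"
  shows "continuous_on S (\<lambda>t. hyperplane_reflection e (l t) (x t))"
  unfolding hyperplane_reflection_def by (intro continuous_intros assms)

lemma integrable_indicator_ball:
  "integrable lborel (indicator (ball z \<delta>) :: 'a::euclidean_space \<Rightarrow> real)"
  by (intro integrable_real_indicator emeasure_bounded_finite) auto

lemma frac_kernel_dist: "frac_kernel \<alpha> (x - y) = dist x y powr - (real DIM('a) + \<alpha>)"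
  for x y :: "'a::euclidean_space"
  by (simp add: frac_kernel_def dist_norm)

section \<open>A maximum principle for antisymmetric functions\<close>

text \<open>For the reflection argument the domain of integration has to be invariant under the reflection that
swaps \<open>x\<close> and \<open>x'\<close>, so that a second ball around \<open>x'\<close> is removed. The kernel is bounded there, so the
error is of the order of the volume of that ball and vanishes with \<open>\<epsilon>\<close>.\<close>

lemma truncated_laplacian_second_hole:
  fixes u :: "'a::euclidean_space \<Rightarrow> real"
  assumes u: "u \<in> L_space \<alpha>" "u \<in> borel_measurable borel" and M: "\<And>y. \<bar>u y\<bar> \<le> M"
    and \<alpha>: "0 < \<alpha>" and \<epsilon>: "0 < \<epsilon>" "\<epsilon> \<le> d" and d: "dist x x' = 2 * d"
  defines "F \<equiv> \<lambda>y. indicator (- (ball x \<epsilon> \<union> ball x' \<epsilon>)) y * ((u x - u y) * frac_kernel \<alpha> (x - y))"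
  shows "integrable lborel F"
    and "\<bar>truncated_laplacian \<alpha> u x \<epsilon> - (LINT y|lborel. F y)\<bar>
      \<le> 2 * M * d powr - (real DIM('a) + \<alpha>) * (unit_ball_vol DIM('a) * \<epsilon> ^ DIM('a))"
proof -
  let ?A = "\<lambda>y. indicator (- ball x \<epsilon>) y * ((u x - u y) * frac_kernel \<alpha> (x - y))"
  let ?c = "2 * M * d powr - (real DIM('a) + \<alpha>)"
  have A: "integrable lborel ?A" by (rule truncated_laplacian_integrable[OF u \<alpha> \<epsilon>(1)])
  have "integrable lborel (\<lambda>y. indicator (- ball x' \<epsilon>) y *\<^sub>R ?A y)"
    by (rule integrable_mult_indicator[OF _ A]) simp
  then show F: "integrable lborel F"
    by (rule Bochner_Integration.integrable_cong[THEN iffD1, rotated 2]) (auto simp: F_def indicator_def)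
  have bound: "\<bar>?A y - F y\<bar> \<le> ?c * indicator (ball x' \<epsilon>) y" for y
  proof (cases "y \<in> ball x' \<epsilon>")
    case True
    have dy: "d \<le> dist x y"
      using dist_triangle[of x x' y] True d \<epsilon> by (simp add: dist_commute)
    have "\<bar>u x - u y\<bar> \<le> 2 * M" using M[of x] M[of y] by linarith
    moreover have "frac_kernel \<alpha> (x - y) \<le> d powr - (real DIM('a) + \<alpha>)"
      unfolding frac_kernel_dist using dy \<epsilon> \<alpha> by (intro powr_mono2') auto
    ultimately have "\<bar>u x - u y\<bar> * frac_kernel \<alpha> (x - y) \<le> ?c"
      using M[of x] by (intro mult_mono) auto
    then show ?thesis using True dy \<epsilon> by (simp add: F_def abs_mult)
  qed (simp add: F_def indicator_def)
  have fin: "integrable lborel (\<lambda>y. ?c * indicator (ball x' \<epsilon>) y)"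
    by (intro integrable_mult_right integrable_indicator_ball)
  have "\<bar>truncated_laplacian \<alpha> u x \<epsilon> - (LINT y|lborel. F y)\<bar> = \<bar>LINT y|lborel. ?A y - F y\<bar>"
    unfolding truncated_laplacian_def using A F by simp
  also have "\<dots> \<le> (LINT y|lborel. ?c * indicator (ball x' \<epsilon>) y)"
    using A F fin bound by (intro order_trans[OF integral_abs_bound] integral_mono) auto
  also have "\<dots> = ?c * (unit_ball_vol DIM('a) * \<epsilon> ^ DIM('a))"
    using \<epsilon> by (simp add: content_ball)
  finally show "\<bar>truncated_laplacian \<alpha> u x \<epsilon> - (LINT y|lborel. F y)\<bar> \<le> \<dots>" .
qed

text \<open>The function \<open>w\<close> of the moving plane method; it is antisymmetric under the reflection, and vanishes on
the hyperplane.\<close>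

definition reflection_difference :: "'a::euclidean_space \<Rightarrow> real \<Rightarrow> ('a \<Rightarrow> real) \<Rightarrow> 'a \<Rightarrow> real" where
  "reflection_difference e l u x = u (hyperplane_reflection e l x) - u x"

text \<open>Folding the integral of \<open>(w x - w y) * frac_kernel \<alpha> (x - y)\<close> along the hyperplane, with \<open>w\<close> the
reflection difference, adds the values at \<open>y\<close> and at the mirror image of \<open>y\<close>. By antisymmetry of \<open>w\<close>
their sum is this expression.\<close>

definition folded_integrand ::
    "'a::euclidean_space \<Rightarrow> real \<Rightarrow> real \<Rightarrow> ('a \<Rightarrow> real) \<Rightarrow> 'a \<Rightarrow> 'a \<Rightarrow> real" where
  "folded_integrand e l \<alpha> u x y =
     frac_kernel \<alpha> (x - y) * (reflection_difference e l u x - reflection_difference e l u y)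
   + frac_kernel \<alpha> (x - hyperplane_reflection e l y)
       * (reflection_difference e l u x + reflection_difference e l u y)"

lemma folded_integrand_reflect:
  assumes e: "norm e = 1"
  shows "folded_integrand e l \<alpha> u x (hyperplane_reflection e l y) = folded_integrand e l \<alpha> u x y"
  unfolding folded_integrand_def reflection_difference_def hyperplane_reflection_involution[OF e]
  by (simp add: algebra_simps)

text \<open>With \<open>K1\<close> and \<open>K2\<close> the kernels at \<open>y\<close> and at its mirror image, the folded integrand is
\<open>2 * K2 * w x - (K1 - K2) * (w y - w x)\<close>, and \<open>K1 \<ge> K2\<close> because \<open>y\<close> is nearer to \<open>x\<close> than its mirror
image is.\<close>

lemma folded_integrand_le:
  assumes e: "norm e = 1" and \<alpha>: "0 < \<alpha>" and x: "x \<bullet> e < l" and y: "y \<bullet> e < l" "y \<noteq> x"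
    and min: "reflection_difference e l u x \<le> reflection_difference e l u y"
  shows "folded_integrand e l \<alpha> u x y
    \<le> 2 * frac_kernel \<alpha> (x - hyperplane_reflection e l y) * reflection_difference e l u x"
proof -
  have "frac_kernel \<alpha> (x - hyperplane_reflection e l y) \<le> frac_kernel \<alpha> (x - y)"
    using dist_less_dist_hyperplane_reflection[OF e x y(1)] y(2) \<alpha>
    by (intro frac_kernel_decreasing) (auto simp: dist_norm)
  with min have "0 \<le> (frac_kernel \<alpha> (x - y) - frac_kernel \<alpha> (x - hyperplane_reflection e l y))
      * (reflection_difference e l u y - reflection_difference e l u x)"
    by (intro mult_nonneg_nonneg) auto
  then show ?thesis unfolding folded_integrand_def by (simp add: algebra_simps)
qed

lemma folded_integrand_nonpos:
  assumes e: "norm e = 1" and \<alpha>: "0 < \<alpha>" and x: "x \<bullet> e < l"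
    and y: "y \<noteq> x" "y \<noteq> hyperplane_reflection e l x"
    and min: "\<And>y. y \<bullet> e < l \<Longrightarrow> reflection_difference e l u x \<le> reflection_difference e l u y"
    and le: "reflection_difference e l u x \<le> 0"
  shows "folded_integrand e l \<alpha> u x y \<le> 0"
proof -
  have below: "folded_integrand e l \<alpha> u x z \<le> 0" if "z \<bullet> e < l" "z \<noteq> x" for z
    using folded_integrand_le[OF e \<alpha> x that min[OF that(1)]]
    by (rule order_trans) (use le in \<open>simp add: mult_nonneg_nonpos\<close>)
  consider "y \<bullet> e < l" | "y \<bullet> e = l" | "y \<bullet> e > l" by linarith
  then show ?thesis
  proof cases
    case 2
    then have "hyperplane_reflection e l y = y" by (simp add: hyperplane_reflection_def)
    then show ?thesis using le
      by (simp add: folded_integrand_def reflection_difference_def mult_nonneg_nonpos)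
  next
    case 3
    then have "hyperplane_reflection e l y \<bullet> e < l" by (simp add: hyperplane_reflection_inner[OF e])
    moreover have "hyperplane_reflection e l y \<noteq> x"
      using y(2) hyperplane_reflection_involution[OF e, of l y] by auto
    ultimately show ?thesis using below folded_integrand_reflect[OF e] by metis
  qed (use below y in blast)
qed

text \<open>The left-hand side is, up to \<open>C\<close>, the principal value integral for \<open>w\<close> at \<open>x\<close>, hence half the
integral of the folded integrand. That integrand is nowhere positive, so the integral only decreases
in absolute value when it is restricted to a ball on which the integrand is known to be at most
\<open>- m\<close>. Working at two points with \<open>u\<close> alone avoids any regularity statement about \<open>w\<close>.\<close>

lemma frac_laplacian_reflection_difference_le:
  fixes u :: "'a::euclidean_space \<Rightarrow> real"
  assumes u: "u \<in> L_space \<alpha> \<inter> C11_loc" and M: "\<And>y. \<bar>u y\<bar> \<le> M"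
    and C: "0 < C" and \<alpha>: "0 < \<alpha>" "\<alpha> < 2" and e: "norm e = 1"
    and x: "x \<bullet> e < l"
    and min: "\<And>y. y \<bullet> e < l \<Longrightarrow> reflection_difference e l u x \<le> reflection_difference e l u y"
    and le: "reflection_difference e l u x \<le> 0"
    and z: "0 < \<delta>" "0 < \<eta>" "\<And>y. y \<in> ball z \<delta> \<Longrightarrow> \<eta> \<le> dist x y \<and> \<eta> \<le> dist (hyperplane_reflection e l x) y"
    and m: "\<And>y. y \<in> ball z \<delta> \<Longrightarrow> folded_integrand e l \<alpha> u x y \<le> - m"
  shows "frac_laplacian C \<alpha> u (hyperplane_reflection e l x) - frac_laplacian C \<alpha> u x
    \<le> C * (- m * (unit_ball_vol DIM('a) * \<delta> ^ DIM('a)) / 2)"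
proof -
  let ?T = "hyperplane_reflection e l"
  define x' where "x' = ?T x"
  define d where "d = l - x \<bullet> e"
  have d: "0 < d" "dist x x' = 2 * d" "dist x' x = 2 * d"
    using x dist_self_hyperplane_reflection[OF e, of x l] by (auto simp: d_def x'_def dist_commute)
  have uL: "u \<in> L_space \<alpha>" and um: "u \<in> borel_measurable borel"
    using u C11_loc_continuous[of u] by (auto intro: borel_measurable_continuous_onI)
  define E where "E \<epsilon> = 2 * M * d powr - (real DIM('a) + \<alpha>) * (unit_ball_vol DIM('a) * \<epsilon> ^ DIM('a))" for \<epsilon>
  define Q where "Q = - m * (unit_ball_vol DIM('a) * \<delta> ^ DIM('a)) / 2"
  have step: "truncated_laplacian \<alpha> u x' \<epsilon> - truncated_laplacian \<alpha> u x \<epsilon> \<le> Q + 2 * E \<epsilon>"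
    if \<epsilon>: "0 < \<epsilon>" "\<epsilon> \<le> d" "\<epsilon> < \<eta>" for \<epsilon>
  proof -
    let ?S = "- (ball x \<epsilon> \<union> ball x' \<epsilon>)"
    let ?F = "\<lambda>x y. indicator ?S y * ((u x - u y) * frac_kernel \<alpha> (x - y))"
    let ?G = "\<lambda>y. ?F x' y - ?F x y"
    have S': "- (ball x' \<epsilon> \<union> ball x \<epsilon>) = ?S" by auto
    note hole = truncated_laplacian_second_hole[OF uL um M \<alpha>(1) \<epsilon>(1,2), folded E_def]
    note h1 = hole[OF d(2)] and h2 = hole[OF d(3), unfolded S']
    have G: "integrable lborel ?G" using h1(1) h2(1) by simp
    then have Gm: "?G \<in> borel_measurable borel" by auto
    note iso = dist_hyperplane_reflection[OF e] hyperplane_reflection_involution[OF e]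
    have GT: "integrable lborel (\<lambda>y. ?G (?T y))" "(LINT y|lborel. ?G (?T y)) = (LINT y|lborel. ?G y)"
      using integral_involutive_isometry[of ?T ?G, OF iso Gm] G by auto
    \<comment> \<open>The substitution \<open>?T\<close> swaps the two kernels, and this is the folding.\<close>
    have sum: "?G y + ?G (?T y) = indicator ?S y * folded_integrand e l \<alpha> u x y" for y
    proof -
      have ST: "indicator ?S (?T y) = (indicator ?S y :: real)"
        using dist_hyperplane_reflection_swap[OF e, of l x y] dist_hyperplane_reflection[OF e, of l x y]
        by (auto simp: indicator_def x'_def)
      have K: "frac_kernel \<alpha> (x' - ?T y) = frac_kernel \<alpha> (x - y)"
          "frac_kernel \<alpha> (x' - y) = frac_kernel \<alpha> (x - ?T y)"
        unfolding frac_kernel_dist x'_def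
        by (simp_all add: dist_hyperplane_reflection_swap[OF e] hyperplane_reflection_involution[OF e])
      show ?thesis unfolding ST K folded_integrand_def reflection_difference_def x'_def[symmetric]
        by (simp add: algebra_simps)
    qed
    have int: "integrable lborel (\<lambda>y. indicator ?S y * folded_integrand e l \<alpha> u x y)"
      using Bochner_Integration.integrable_add[OF G GT(1)] unfolding sum .
    have bound: "indicator ?S y * folded_integrand e l \<alpha> u x y \<le> - m * indicator (ball z \<delta>) y" for y
    proof (cases "y \<in> ball z \<delta>")
      case True
      then have "y \<in> ?S" using z(3)[OF True] \<epsilon> by (auto simp: x'_def)
      then show ?thesis using m[OF True] True by simp
    next
      case False
      have "folded_integrand e l \<alpha> u x y \<le> 0" if "y \<in> ?S"
        using that \<epsilon> by (intro folded_integrand_nonpos[OF e \<alpha>(1) x _ _ min le]) (auto simp: x'_def)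
      then show ?thesis using False by (cases "y \<in> ?S") auto
    qed
    have "2 * (LINT y|lborel. ?G y) = (LINT y|lborel. ?G y + ?G (?T y))"
      using Bochner_Integration.integral_add[OF G GT(1)] GT(2) by simp
    also have "\<dots> \<le> (LINT y|lborel. - m * indicator (ball z \<delta>) y)"
      unfolding sum using int bound by (intro integral_mono integrable_mult_right integrable_indicator_ball) auto
    also have "\<dots> = 2 * Q"
      using z(1) by (simp add: content_ball Q_def)
    finally have "(LINT y|lborel. ?G y) \<le> Q" by simp
    moreover have "(LINT y|lborel. ?G y) = (LINT y|lborel. ?F x' y) - (LINT y|lborel. ?F x y)"
      using h1(1) h2(1) by (intro Bochner_Integration.integral_diff)
    ultimately show ?thesis using h1(2) h2(2) by linarith
  qed
  have lim: "((\<lambda>\<epsilon>. C * truncated_laplacian \<alpha> u x' \<epsilon> - C * truncated_laplacian \<alpha> u x \<epsilon>) \<longlongrightarrow>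
      frac_laplacian C \<alpha> u x' - frac_laplacian C \<alpha> u x) (at_right 0)"
    by (intro tendsto_diff frac_laplacian_limit[OF u \<alpha>])
  have "((\<lambda>\<epsilon>. C * (Q + 2 * E \<epsilon>)) \<longlongrightarrow> C * (Q + 2 * 0)) (at_right 0)"
  proof -
    have "((\<lambda>\<epsilon>. E \<epsilon>) \<longlongrightarrow> E 0) (at_right 0)" unfolding E_def by (intro tendsto_intros)
    moreover have "E 0 = 0" by (simp add: E_def)
    ultimately have "(E \<longlongrightarrow> 0) (at_right 0)" by simp
    then show ?thesis by (intro tendsto_intros)
  qed
  moreover have "\<forall>\<^sub>F \<epsilon> in at_right 0. C * truncated_laplacian \<alpha> u x' \<epsilon> - C * truncated_laplacian \<alpha> u x \<epsilon>
      \<le> C * (Q + 2 * E \<epsilon>)"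
    using eventually_at_right_real[of 0 "min d \<eta>"] d(1) z(2)
    by (auto elim!: eventually_mono simp: right_diff_distrib[symmetric] C
        intro!: mult_left_mono step less_imp_le[OF C])
  ultimately have "frac_laplacian C \<alpha> u x' - frac_laplacian C \<alpha> u x \<le> C * (Q + 2 * 0)"
    using lim by (intro tendsto_le[of "at_right (0::real)"]) auto
  then show ?thesis by (simp add: x'_def Q_def)
qed

text \<open>The quantitative form of the maximum principle. With \<open>d\<close> the distance of \<open>x\<close> from the hyperplane, a
ball of radius \<open>d\<close> at distance of order \<open>d\<close> from \<open>x\<close> has volume of order \<open>d ^ DIM('a)\<close>, while the
kernel there is of order \<open>d powr - (DIM('a) + \<alpha>)\<close>. The product gives the weight \<open>d powr - \<alpha>\<close>,
which is large near the hyperplane and decays only like \<open>norm x powr - \<alpha>\<close> far away from the origin.\<close>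

lemma frac_laplacian_at_antisymmetric_minimum:
  fixes u :: "'a::euclidean_space \<Rightarrow> real"
  assumes u: "u \<in> L_space \<alpha> \<inter> C11_loc" and M: "\<And>y. \<bar>u y\<bar> \<le> M"
    and C: "0 < C" and \<alpha>: "0 < \<alpha>" "\<alpha> < 2" and e: "norm e = 1"
    and x: "x \<bullet> e < l"
    and min: "\<And>y. y \<bullet> e < l \<Longrightarrow> reflection_difference e l u x \<le> reflection_difference e l u y"
    and le: "reflection_difference e l u x \<le> 0"
  shows "frac_laplacian C \<alpha> u (hyperplane_reflection e l x) - frac_laplacian C \<alpha> u x
    \<le> C * unit_ball_vol DIM('a) * 6 powr - (real DIM('a) + \<alpha>) * (l - x \<bullet> e) powr - \<alpha>
        * reflection_difference e l u x"
proof -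
  define N where "N = real DIM('a) + \<alpha>"
  define d where "d = l - x \<bullet> e"
  \<comment> \<open>The ball of radius \<open>d\<close> around \<open>z\<close> avoids \<open>x\<close>, lies on the same side of the hyperplane as \<open>x\<close>, and lies within \<open>6 * d\<close> of the mirror image of \<open>x\<close>.\<close>
  define z where "z = x - (3 * d) *\<^sub>R e"
  define x' where "x' = hyperplane_reflection e l x"
  have d: "0 < d" using x by (simp add: d_def)
  have xz: "dist x z = 3 * d" using d e by (simp add: z_def dist_norm)
  have xx': "dist x x' = 2 * d"
    using x dist_self_hyperplane_reflection[OF e, of x l] by (simp add: d_def x'_def)
  have yprops: "y \<bullet> e < l" "2 * d \<le> dist x y" "dist x' y \<le> 6 * d" "d \<le> dist x' y" if "y \<in> ball z d" for y
  proof -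
    have zy: "dist z y < d" using that by simp
    show x1: "2 * d \<le> dist x y" using dist_triangle[of x z y] xz zy by (simp add: dist_commute)
    have "dist x y \<le> 4 * d" using dist_triangle[of x y z] xz zy by (simp add: dist_commute)
    then show "dist x' y \<le> 6 * d" using dist_triangle[of x' y x] xx' by (simp add: dist_commute)
    have "\<bar>(y - z) \<bullet> e\<bar> \<le> norm (y - z) * norm e" by (rule Cauchy_Schwarz_ineq2)
    then have "(y - z) \<bullet> e < d" using zy e by (simp add: dist_norm norm_minus_commute)
    moreover have "z \<bullet> e = x \<bullet> e - 3 * d"
      by (simp add: z_def inner_diff_left inner_unit[OF e])
    ultimately show ye: "y \<bullet> e < l" using d by (simp add: inner_diff_left d_def)
    have "dist x y < dist x (hyperplane_reflection e l y)"
      by (rule dist_less_dist_hyperplane_reflection[OF e x ye])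
    then show "d \<le> dist x' y"
      using x1 d by (simp add: x'_def dist_hyperplane_reflection_swap[OF e])
  qed
  define m where "m = - 2 * (6 * d) powr - N * reflection_difference e l u x"
  have "frac_laplacian C \<alpha> u x' - frac_laplacian C \<alpha> u x
      \<le> C * (- m * (unit_ball_vol DIM('a) * d ^ DIM('a)) / 2)"
    unfolding x'_def
  proof (rule frac_laplacian_reflection_difference_le[OF u M C \<alpha> e x min le d d])
    fix y assume y: "y \<in> ball z d"
    note p = yprops[OF y]
    show "d \<le> dist x y \<and> d \<le> dist (hyperplane_reflection e l x) y"
      using p d by (simp add: x'_def)
    have "(6 * d) powr - N \<le> frac_kernel \<alpha> (x - hyperplane_reflection e l y)"
      unfolding frac_kernel_dist N_def using p d \<alpha>
      by (intro powr_mono2') (auto simp: x'_def dist_hyperplane_reflection_swap[OF e])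
    then have "frac_kernel \<alpha> (x - hyperplane_reflection e l y) * reflection_difference e l u x
        \<le> (6 * d) powr - N * reflection_difference e l u x"
      using le by (intro mult_right_mono_neg) auto
    moreover have "y \<noteq> x" using p(2) d by auto
    ultimately show "folded_integrand e l \<alpha> u x y \<le> - m"
      using folded_integrand_le[OF e \<alpha>(1) x p(1) _ min[OF p(1)]] unfolding m_def by fastforce
  qed
  also have "- m * (unit_ball_vol DIM('a) * d ^ DIM('a)) / 2
      = unit_ball_vol DIM('a) * ((6 * d) powr - N * d powr real DIM('a)) * reflection_difference e l u x"
    using d by (simp add: m_def powr_realpow)
  also have "(6 * d) powr - N * d powr real DIM('a) = 6 powr - N * d powr - \<alpha>"
    by (simp add: powr_mult powr_add[symmetric] N_def)
  finally show ?thesis by (simp add: x'_def N_def d_def mult.assoc)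
qed

text \<open>The strong form: if \<open>w\<close> vanishes at \<open>x\<close>, the folded integrand is \<open>- (K1 - K2) * w y\<close>, which is
strictly negative wherever \<open>w y > 0\<close>, and by continuity stays so on a small ball.\<close>

lemma frac_laplacian_at_interior_zero:
  fixes u :: "'a::euclidean_space \<Rightarrow> real"
  assumes u: "u \<in> L_space \<alpha> \<inter> C11_loc" and M: "\<And>y. \<bar>u y\<bar> \<le> M"
    and C: "0 < C" and \<alpha>: "0 < \<alpha>" "\<alpha> < 2" and e: "norm e = 1"
    and x: "x \<bullet> e < l"
    and nonneg: "\<And>y. y \<bullet> e < l \<Longrightarrow> 0 \<le> reflection_difference e l u y"
    and zero: "reflection_difference e l u x = 0"
    and y: "y \<bullet> e < l" "0 < reflection_difference e l u y"
  shows "frac_laplacian C \<alpha> u (hyperplane_reflection e l x) < frac_laplacian C \<alpha> u x"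
proof -
  let ?T = "hyperplane_reflection e l"
  let ?f = "folded_integrand e l \<alpha> u x"
  have yx: "y \<noteq> x" "y \<noteq> ?T x"
    using y zero x by (auto simp: hyperplane_reflection_inner[OF e])
  define N where "N = real DIM('a) + \<alpha>"
  have N: "0 < N" using \<alpha> by (simp add: N_def)
  have lt: "dist x y < dist x (?T y)" by (rule dist_less_dist_hyperplane_reflection[OF e x y(1)])
  have "frac_kernel \<alpha> (x - ?T y) < frac_kernel \<alpha> (x - y)"
    unfolding frac_kernel_dist N_def[symmetric] using lt yx N by (intro powr_less_mono2_neg) auto
  then have neg: "?f y < 0"
    using y unfolding folded_integrand_def zero by (simp add: mult_less_cancel_right algebra_simps)
  have ucont: "continuous_on UNIV u" using u C11_loc_continuous by blast
  have cont: "continuous_on (- {x, ?T x}) ?f"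
  proof -
    have "continuous_on S (\<lambda>y. u (?T y))" for S
      by (rule continuous_on_compose2[OF ucont]) (auto intro!: continuous_intros)
    moreover have "x \<noteq> ?T y" if "y \<noteq> ?T x" for y
      using that hyperplane_reflection_involution[OF e] by metis
    ultimately show ?thesis
      unfolding folded_integrand_def reflection_difference_def frac_kernel_dist
      by (intro continuous_intros continuous_on_subset[OF ucont]) auto
  qed
  have "open (- {x, ?T x})" by (intro open_Compl finite_imp_closed) auto
  have "?f \<midarrow>y\<rightarrow> ?f y"
    using cont yx \<open>open (- {x, ?T x})\<close> by (simp add: continuous_on_eq_continuous_at isCont_def)
  then have "\<forall>\<^sub>F z in at y. ?f z < ?f y / 2" using neg by (intro order_tendstoD(2)) auto
  then obtain \<delta>0 where \<delta>0: "0 < \<delta>0" "\<And>z. z \<noteq> y \<Longrightarrow> dist z y < \<delta>0 \<Longrightarrow> ?f z < ?f y / 2"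
    unfolding eventually_at by auto
  define \<eta> where "\<eta> = min (dist x y) (dist (?T x) y) / 2"
  have \<eta>: "0 < \<eta>" using yx by (simp add: \<eta>_def)
  define \<delta> where "\<delta> = min \<delta>0 \<eta>"
  have \<delta>: "0 < \<delta>" using \<delta>0 \<eta> by (simp add: \<delta>_def)
  have "frac_laplacian C \<alpha> u (?T x) - frac_laplacian C \<alpha> u x
      \<le> C * (- (- ?f y / 2) * (unit_ball_vol DIM('a) * \<delta> ^ DIM('a)) / 2)"
  proof (rule frac_laplacian_reflection_difference_le[OF u M C \<alpha> e x _ _ \<delta> \<eta>])
    fix z assume z: "z \<in> ball y \<delta>"
    then have "dist y z < \<eta>" by (simp add: \<delta>_def)
    then show "\<eta> \<le> dist x z \<and> \<eta> \<le> dist (?T x) z"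
      using dist_triangle[of x y z] dist_triangle[of "?T x" y z]
      unfolding \<eta>_def by (auto simp: dist_commute min_def split: if_splits)
    show "?f z \<le> - (- ?f y / 2)"
      using \<delta>0(2)[of z] z neg by (cases "z = y") (auto simp: \<delta>_def dist_commute)
  qed (use nonneg zero in auto)
  also have "\<dots> < 0"
  proof -
    have "0 < C * (unit_ball_vol DIM('a) * \<delta> ^ DIM('a)) / 4" using C \<delta> by simp
    from mult_pos_neg[OF this neg] show ?thesis by (simp add: mult_ac)
  qed
  finally show ?thesis by simp
qed

section \<open>The nonlinearity\<close>

text \<open>The operators \<open>partial1\<close> and \<open>partial2\<close> are defined through \<open>deriv\<close>, so that they have to be identified
with values of the total derivative. On the open quadrant this derivative is two-sided; it
is continuous up to the boundary, which bounds it on bounded parts of the quadrant.\<close>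

lemma C1_on_quadrant_partials:
  fixes f :: "real \<Rightarrow> real \<Rightarrow> real"
  assumes f: "C1_on (\<lambda>(s, t). f s t) ({0..} \<times> {0..})"
  shows "\<And>s t. 0 < s \<Longrightarrow> 0 < t \<Longrightarrow> ((\<lambda>x. f x t) has_real_derivative partial1 f s t) (at s)"
    and "\<And>s t. 0 < s \<Longrightarrow> 0 < t \<Longrightarrow> ((\<lambda>y. f s y) has_real_derivative partial2 f s t) (at t)"
    and "\<And>M. \<exists>B\<ge>0. \<forall>s t. 0 < s \<longrightarrow> s \<le> M \<longrightarrow> 0 < t \<longrightarrow> t \<le> M \<longrightarrow>
      partial1 f s t \<le> B \<and> partial2 f s t \<le> B"
proof -
  let ?S = "{0::real..} \<times> {0::real..}"
  obtain f' :: "real \<times> real \<Rightarrow> (real \<times> real) \<Rightarrow>\<^sub>L real"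
    where f': "\<And>z. z \<in> ?S \<Longrightarrow> ((\<lambda>(s, t). f s t) has_derivative blinfun_apply (f' z)) (at z within ?S)"
      and cont: "continuous_on ?S f'"
    using f unfolding C1_on_def by blast
  have der: "((\<lambda>(s, t). f s t) has_derivative blinfun_apply (f' (s, t))) (at (s, t))"
    if "0 < s" "0 < t" for s t
  proof -
    have sub: "{0::real<..} \<times> {0::real<..} \<subseteq> ?S" by (intro Sigma_mono) auto
    have "open ({0::real<..} \<times> {0::real<..})" by (intro open_Times) auto
    from interior_maximal[OF sub this] have "(s, t) \<in> interior ?S"
      by (rule subsetD) (use that in simp)
    then have "at (s, t) within ?S = at (s, t)" by (rule at_within_interior)
    moreover have "(s, t) \<in> ?S" using that by simp
    ultimately show ?thesis using f' by metis
  qed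
  have d1: "((\<lambda>x. f x t) has_real_derivative blinfun_apply (f' (s, t)) (1, 0)) (at s)"
    if "0 < s" "0 < t" for s t
  proof -
    have "((\<lambda>x. (x, t)) has_derivative (\<lambda>h. (h, 0))) (at s)"
      by (auto intro!: derivative_eq_intros)
    from has_derivative_compose[OF this der[OF that]] have
      "((\<lambda>x. f x t) has_derivative (\<lambda>h. blinfun_apply (f' (s, t)) (h, 0))) (at s)" by simp
    moreover have "(\<lambda>h. blinfun_apply (f' (s, t)) (h, 0)) = (*) (blinfun_apply (f' (s, t)) (1, 0))"
    proof
      fix h :: real
      have "(h, 0) = h *\<^sub>R (1::real, 0::real)" unfolding scaleR_Pair by simp
      then have "blinfun_apply (f' (s, t)) (h, 0) = h *\<^sub>R blinfun_apply (f' (s, t)) (1, 0)"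
        unfolding blinfun.scaleR_right[symmetric] by (rule arg_cong)
      then show "blinfun_apply (f' (s, t)) (h, 0) = blinfun_apply (f' (s, t)) (1, 0) * h"
        unfolding real_scaleR_def by (rule trans) (rule mult.commute)
    qed
    ultimately show ?thesis unfolding has_field_derivative_def by (simp only:)
  qed
  have d2: "((\<lambda>y. f s y) has_real_derivative blinfun_apply (f' (s, t)) (0, 1)) (at t)"
    if "0 < s" "0 < t" for s t
  proof -
    have "((\<lambda>y. (s, y)) has_derivative (\<lambda>h. (0, h))) (at t)"
      by (auto intro!: derivative_eq_intros)
    from has_derivative_compose[OF this der[OF that]] have
      "((\<lambda>y. f s y) has_derivative (\<lambda>h. blinfun_apply (f' (s, t)) (0, h))) (at t)" by simp
    moreover have "(\<lambda>h. blinfun_apply (f' (s, t)) (0, h)) = (*) (blinfun_apply (f' (s, t)) (0, 1))"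
    proof
      fix h :: real
      have "(0, h) = h *\<^sub>R (0::real, 1::real)" unfolding scaleR_Pair by simp
      then have "blinfun_apply (f' (s, t)) (0, h) = h *\<^sub>R blinfun_apply (f' (s, t)) (0, 1)"
        unfolding blinfun.scaleR_right[symmetric] by (rule arg_cong)
      then show "blinfun_apply (f' (s, t)) (0, h) = blinfun_apply (f' (s, t)) (0, 1) * h"
        unfolding real_scaleR_def by (rule trans) (rule mult.commute)
    qed
    ultimately show ?thesis unfolding has_field_derivative_def by (simp only:)
  qed
  have p1: "partial1 f s t = blinfun_apply (f' (s, t)) (1, 0)"
    and p2: "partial2 f s t = blinfun_apply (f' (s, t)) (0, 1)" if "0 < s" "0 < t" for s t
    using d1[OF that] d2[OF that] unfolding partial1_def partial2_def by (auto intro: DERIV_imp_deriv)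
  show "((\<lambda>x. f x t) has_real_derivative partial1 f s t) (at s)" if "0 < s" "0 < t" for s t
    using d1[OF that] unfolding p1[OF that] .
  show "((\<lambda>y. f s y) has_real_derivative partial2 f s t) (at t)" if "0 < s" "0 < t" for s t
    using d2[OF that] unfolding p2[OF that] .
  show "\<exists>B\<ge>0. \<forall>s t. 0 < s \<longrightarrow> s \<le> M \<longrightarrow> 0 < t \<longrightarrow> t \<le> M \<longrightarrow>
      partial1 f s t \<le> B \<and> partial2 f s t \<le> B" for M
  proof -
    have "compact ({0..M} \<times> {0..M})" by (intro compact_Times) auto
    moreover have "continuous_on ({0..M} \<times> {0..M}) f'"
      by (rule continuous_on_subset[OF cont]) auto
    ultimately have "bounded (f' ` ({0..M} \<times> {0..M}))"
      by (intro compact_imp_bounded compact_continuous_image)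
    then obtain B where B: "0 < B" "\<And>z. z \<in> {0..M} \<times> {0..M} \<Longrightarrow> norm (f' z) \<le> B"
      unfolding bounded_pos by auto
    have "blinfun_apply (f' (s, t)) h \<le> B" if "0 < s" "s \<le> M" "0 < t" "t \<le> M" "norm h = 1" for s t h
    proof -
      have "norm (blinfun_apply (f' (s, t)) h) \<le> norm (f' (s, t)) * norm h" by (rule norm_blinfun)
      also have "\<dots> \<le> B" using B(2)[of "(s, t)"] that by simp
      finally show ?thesis by simp
    qed
    then show ?thesis using B(1) by (intro exI[of _ B]) (auto simp: p1 p2 norm_Pair)
  qed
qed

text \<open>This is all that the moving plane argument has to know about the equation for \<open>u\<close>. At a negative
minimum of the reflection difference of \<open>u\<close>, far from the origin or close to the hyperplane, the
depth of that minimum is at most half of any bound \<open>Z\<close> on the depth of the reflection difference of \<open>v\<close>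
at the same point. If this holds with \<open>u\<close> and \<open>v\<close> exchanged as well, such minima cannot exist. The condition on \<open>l\<close> makes the distance of
a far point \<open>x\<close> from the hyperplane at most \<open>2 * norm x\<close>.\<close>

definition negative_minima_dominated ::
    "('a::euclidean_space \<Rightarrow> real) \<Rightarrow> ('a \<Rightarrow> real) \<Rightarrow> real \<Rightarrow> real \<Rightarrow> bool" where
  "negative_minima_dominated u v R \<eta> \<longleftrightarrow>
     (\<forall>e l x Z. norm e = 1 \<longrightarrow> x \<bullet> e < l \<longrightarrow>
      (\<forall>y. y \<bullet> e < l \<longrightarrow> reflection_difference e l u x \<le> reflection_difference e l u y) \<longrightarrow>
      reflection_difference e l u x < 0 \<longrightarrow> 0 \<le> Z \<longrightarrow> - Z \<le> reflection_difference e l v x \<longrightarrow>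
      R < norm x \<and> \<bar>l\<bar> \<le> norm x \<or> l - x \<bullet> e < \<eta> \<longrightarrow>
      - reflection_difference e l u x \<le> Z / 2)"

lemma negative_minima_dominatedD:
  assumes "negative_minima_dominated u v R \<eta>" "norm e = 1" "x \<bullet> e < l"
    and "\<And>y. y \<bullet> e < l \<Longrightarrow> reflection_difference e l u x \<le> reflection_difference e l u y"
    and "reflection_difference e l u x < 0" "0 \<le> Z" "- Z \<le> reflection_difference e l v x"
    and "R < norm x \<and> \<bar>l\<bar> \<le> norm x \<or> l - x \<bullet> e < \<eta>"
  shows "- reflection_difference e l u x \<le> Z / 2"
  using assms unfolding negative_minima_dominated_def by blast

lemma negative_minima_dominated_mono:
  assumes "negative_minima_dominated u v R \<eta>" "R \<le> R'" "\<eta>' \<le> \<eta>"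
  shows "negative_minima_dominated u v R' \<eta>'"
  unfolding negative_minima_dominated_def
proof (intro allI impI)
  fix e l x Z
  assume *: "norm e = 1" "x \<bullet> e < l"
      "\<forall>y. y \<bullet> e < l \<longrightarrow> reflection_difference e l u x \<le> reflection_difference e l u y"
      "reflection_difference e l u x < 0" "0 \<le> Z" "- Z \<le> reflection_difference e l v x"
      "R' < norm x \<and> \<bar>l\<bar> \<le> norm x \<or> l - x \<bullet> e < \<eta>'"
  from *(7) assms(2,3) have "R < norm x \<and> \<bar>l\<bar> \<le> norm x \<or> l - x \<bullet> e < \<eta>" by auto
  then show "- reflection_difference e l u x \<le> Z / 2"
    using *(1-6) by (intro negative_minima_dominatedD[OF assms(1)]) auto
qed

text \<open>One equation of the system. The other one is an instance as well, with the two arguments of its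
nonlinearity exchanged; the assumptions are therefore on \<open>f\<close> only, and not on a pair \<open>f\<close>, \<open>g\<close>.
The two conditions \<open>subcritical\<close> say that the bounds on \<open>partial1 f\<close> and \<open>partial2 f\<close>, evaluated at the
decay rates of \<open>u\<close> and \<open>v\<close>, decay faster than \<open>norm x powr - \<alpha>\<close>.\<close>

locale decaying_cooperative_nonlinearity =
  fixes f :: "real \<Rightarrow> real \<Rightarrow> real" and \<alpha> a b p q :: real
  assumes partial1: "\<And>s t. 0 < s \<Longrightarrow> 0 < t \<Longrightarrow> ((\<lambda>x. f x t) has_real_derivative partial1 f s t) (at s)"
    and partial2: "\<And>s t. 0 < s \<Longrightarrow> 0 < t \<Longrightarrow> ((\<lambda>y. f s y) has_real_derivative partial2 f s t) (at t)"
    and partials_bounded: "\<And>M. \<exists>B\<ge>0. \<forall>s t. 0 < s \<longrightarrow> s \<le> M \<longrightarrow> 0 < t \<longrightarrow> t \<le> M \<longrightarrow>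
      partial1 f s t \<le> B \<and> partial2 f s t \<le> B"
    and partial2_pos: "\<And>s t. 0 < s \<Longrightarrow> 0 < t \<Longrightarrow> 0 < partial2 f s t"
    and partial1_origin: "lesssim_origin (partial1 f) (\<lambda>x y. x powr (p - 1) * y powr q)"
    and partial2_origin: "lesssim_origin (partial2 f) (\<lambda>x y. x powr p * y powr (q - 1))"
    and exponents_pos: "0 < \<alpha>" "0 < a" "0 < b" "1 \<le> p" "1 \<le> q"
    and subcritical: "\<alpha> < a * p + b * q - a" "\<alpha> < a * p + b * q - b"
begin

lemma strict_mono_second:
  assumes "0 < s" "0 < t" "t < t'"
  shows "f s t < f s t'"
  using assms partial2 partial2_pos by (intro DERIV_pos_imp_increasing[of t t' "f s"]) (meson less_le_trans)+

text \<open>Only upper bounds on the partial derivatives are at hand. They suffice, as the first argument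
decreases from \<open>u\<close> to \<open>U\<close>, and as an increase of the second argument only helps by monotonicity.\<close>

lemma difference_lower_bound:
  assumes pos: "0 < U" "U < u" "0 < V" "0 < v" and B: "0 \<le> B2"
    and bound: "\<And>s t. 0 < s \<Longrightarrow> s \<le> u \<Longrightarrow> 0 < t \<Longrightarrow> t \<le> v \<Longrightarrow> partial1 f s t \<le> B1 \<and> partial2 f s t \<le> B2"
  shows "- B1 * (u - U) - B2 * max 0 (v - V) \<le> f U V - f u v"
proof -
  have "\<exists>z>U. z < u \<and> f u v - f U v = (u - U) * partial1 f z v"
    using pos partial1 by (intro MVT2) auto
  then obtain z where z: "U < z" "z < u" "f u v - f U v = (u - U) * partial1 f z v" by blast
  then have "f u v - f U v \<le> (u - U) * B1"
    using bound[of z v] pos by simp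
  moreover have "- B2 * max 0 (v - V) \<le> f U V - f U v"
  proof (cases "V < v")
    case True
    have "\<exists>z>V. z < v \<and> f U v - f U V = (v - V) * partial2 f U z"
      using pos True partial2 by (intro MVT2) auto
    then obtain z where z: "V < z" "z < v" "f U v - f U V = (v - V) * partial2 f U z" by blast
    then have "f U v - f U V \<le> (v - V) * B2"
      using bound[of U z] pos True by simp
    then show ?thesis using True by (simp add: mult.commute)
  next
    case False
    then have "f U v \<le> f U V"
      using strict_mono_second[of U v V] pos by (cases "v = V") auto
    then show ?thesis using False by simp
  qed
  ultimately show ?thesis by (simp add: algebra_simps)
qed

text \<open>With \<open>u \<le> \<rho> powr - a\<close> and \<open>v \<le> \<rho> powr - b\<close>, both partial derivatives are bounded by powers of \<open>\<rho>\<close>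
with exponents below \<open>- \<alpha>\<close>, hence by \<open>\<kappa> * d powr - \<alpha>\<close> for all \<open>d \<le> 2 * \<rho>\<close> when \<open>\<rho>\<close> is large.\<close>

lemma difference_lower_bound_far:
  assumes \<kappa>: "0 < \<kappa>"
  shows "\<exists>R>0. \<forall>\<rho> d u v U V. R < \<rho> \<longrightarrow> 0 < d \<longrightarrow> d \<le> 2 * \<rho> \<longrightarrow> u \<le> \<rho> powr - a \<longrightarrow> v \<le> \<rho> powr - b \<longrightarrow>
    0 < U \<longrightarrow> U < u \<longrightarrow> 0 < V \<longrightarrow> 0 < v \<longrightarrow>
    - \<kappa> * d powr - \<alpha> * ((u - U) + max 0 (v - V)) \<le> f U V - f u v"
proof -
  obtain \<delta>1 where \<delta>1: "0 < \<delta>1" "\<And>s t. 0 < s \<Longrightarrow> 0 < t \<Longrightarrow> s + t < \<delta>1 \<Longrightarrow> partial1 f s t \<le> s powr (p - 1) * t powr q"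
    using partial1_origin unfolding lesssim_origin_def by blast
  obtain \<delta>2 where \<delta>2: "0 < \<delta>2" "\<And>s t. 0 < s \<Longrightarrow> 0 < t \<Longrightarrow> s + t < \<delta>2 \<Longrightarrow> partial2 f s t \<le> s powr p * t powr (q - 1)"
    using partial2_origin unfolding lesssim_origin_def by blast
  \<comment> \<open>At the decay rates of \<open>u\<close> and \<open>v\<close>, the bounds on the partial derivatives are \<open>\<rho> powr - E1\<close> and \<open>\<rho> powr - E2\<close>.\<close>
  define E1 where "E1 = a * (p - 1) + b * q"
  define E2 where "E2 = a * p + b * (q - 1)"
  have E: "\<alpha> - E1 < 0" "\<alpha> - E2 < 0" using subcritical by (auto simp: E1_def E2_def algebra_simps)
  \<comment> \<open>The factor \<open>2 powr - \<alpha>\<close> compensates \<open>d \<le> 2 * \<rho>\<close>.\<close>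
  define \<kappa>' where "\<kappa>' = \<kappa> * 2 powr - \<alpha>"
  have \<kappa>': "0 < \<kappa>'" using \<kappa> by (simp add: \<kappa>'_def)
  have small: "\<forall>\<^sub>F \<rho> in at_top. \<rho> powr s < c" if "s < 0" "0 < c" for s c :: real
    using order_tendstoD(2)[OF tendsto_neg_powr[OF that(1) filterlim_ident] that(2)] .
  have "\<forall>\<^sub>F \<rho> in at_top. 0 < \<rho> \<and> \<rho> powr - a < min \<delta>1 \<delta>2 / 2 \<and> \<rho> powr - b < min \<delta>1 \<delta>2 / 2
      \<and> \<rho> powr (\<alpha> - E1) < \<kappa>' \<and> \<rho> powr (\<alpha> - E2) < \<kappa>'"
    using \<delta>1(1) \<delta>2(1) exponents_pos E \<kappa>'
    by (intro eventually_conj small eventually_gt_at_top) auto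
  then obtain R0 where R0: "\<And>\<rho>. R0 \<le> \<rho> \<Longrightarrow> 0 < \<rho> \<and> \<rho> powr - a < min \<delta>1 \<delta>2 / 2 \<and> \<rho> powr - b < min \<delta>1 \<delta>2 / 2
      \<and> \<rho> powr (\<alpha> - E1) < \<kappa>' \<and> \<rho> powr (\<alpha> - E2) < \<kappa>'"
    unfolding eventually_at_top_linorder by blast
  have "- \<kappa> * d powr - \<alpha> * ((u - U) + max 0 (v - V)) \<le> f U V - f u v"
    if \<rho>: "max R0 1 < \<rho>" and d: "0 < d" "d \<le> 2 * \<rho>" and uv: "u \<le> \<rho> powr - a" "v \<le> \<rho> powr - b"
      and pos: "0 < U" "U < u" "0 < V" "0 < v" for \<rho> d u v U V
  proof -
    have r: "0 < \<rho>" "\<rho> powr - a < min \<delta>1 \<delta>2 / 2" "\<rho> powr - b < min \<delta>1 \<delta>2 / 2"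
        "\<rho> powr (\<alpha> - E1) < \<kappa>'" "\<rho> powr (\<alpha> - E2) < \<kappa>'"
      using R0[of \<rho>] \<rho> by auto
    have "- (\<rho> powr - E1) * (u - U) - \<rho> powr - E2 * max 0 (v - V) \<le> f U V - f u v"
    proof (rule difference_lower_bound[OF pos])
      fix s t :: real assume st: "0 < s" "s \<le> u" "0 < t" "t \<le> v"
      have s: "s \<le> \<rho> powr - a" and t: "t \<le> \<rho> powr - b" using st uv by auto
      then have "s + t < \<delta>1" "s + t < \<delta>2" using r(2,3) by auto
      then have "partial1 f s t \<le> s powr (p - 1) * t powr q" "partial2 f s t \<le> s powr p * t powr (q - 1)"
        using \<delta>1(2) \<delta>2(2) st by auto
      moreover have "s powr (p - 1) * t powr q \<le> (\<rho> powr - a) powr (p - 1) * (\<rho> powr - b) powr q"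
        using s t st exponents_pos by (intro mult_mono powr_mono2) auto
      moreover have "(\<rho> powr - a) powr (p - 1) * (\<rho> powr - b) powr q = \<rho> powr - E1"
        by (simp add: powr_powr powr_add[symmetric] E1_def algebra_simps)
      moreover have "s powr p * t powr (q - 1) \<le> (\<rho> powr - a) powr p * (\<rho> powr - b) powr (q - 1)"
        using s t st exponents_pos by (intro mult_mono powr_mono2) auto
      moreover have "(\<rho> powr - a) powr p * (\<rho> powr - b) powr (q - 1) = \<rho> powr - E2"
        by (simp add: powr_powr powr_add[symmetric] E2_def algebra_simps)
      ultimately show "partial1 f s t \<le> \<rho> powr - E1 \<and> partial2 f s t \<le> \<rho> powr - E2" by linarith
    qed simp
    moreover have weight: "\<rho> powr - E' \<le> \<kappa> * d powr - \<alpha>" if "\<rho> powr (\<alpha> - E') < \<kappa>'" for E'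
    proof -
      have "\<rho> powr - E' = \<rho> powr (\<alpha> - E') * \<rho> powr - \<alpha>" by (simp add: powr_add[symmetric])
      also have "\<dots> \<le> \<kappa>' * \<rho> powr - \<alpha>" using that by (intro mult_right_mono) auto
      also have "\<dots> = \<kappa> * (2 * \<rho>) powr - \<alpha>" by (simp add: \<kappa>'_def powr_mult)
      also have "\<dots> \<le> \<kappa> * d powr - \<alpha>"
        using d \<kappa> exponents_pos(1) by (intro mult_left_mono powr_mono2') auto
      finally show ?thesis .
    qed
    moreover have "\<rho> powr - E1 * (u - U) \<le> \<kappa> * d powr - \<alpha> * (u - U)"
      using weight[OF r(4)] pos by (intro mult_right_mono) auto
    moreover have "\<rho> powr - E2 * max 0 (v - V) \<le> \<kappa> * d powr - \<alpha> * max 0 (v - V)"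
      using weight[OF r(5)] by (intro mult_right_mono) auto
    ultimately show ?thesis by (simp add: distrib_left)
  qed
  then show ?thesis by (intro exI[of _ "max R0 1"]) auto
qed

text \<open>Close to the hyperplane no smallness of \<open>u\<close> and \<open>v\<close> is needed: the weight \<open>d powr - \<alpha>\<close> exceeds any
bound \<open>B\<close> on the partial derivatives.\<close>

lemma difference_lower_bound_narrow:
  assumes \<kappa>: "0 < \<kappa>"
  shows "\<exists>\<eta>>0. \<forall>d u v U V. 0 < d \<longrightarrow> d < \<eta> \<longrightarrow> u \<le> M \<longrightarrow> v \<le> M \<longrightarrow>
    0 < U \<longrightarrow> U < u \<longrightarrow> 0 < V \<longrightarrow> 0 < v \<longrightarrow>
    - \<kappa> * d powr - \<alpha> * ((u - U) + max 0 (v - V)) \<le> f U V - f u v"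
proof -
  obtain B where B: "0 \<le> B" "\<And>s t. 0 < s \<Longrightarrow> s \<le> M \<Longrightarrow> 0 < t \<Longrightarrow> t \<le> M \<Longrightarrow>
      partial1 f s t \<le> B \<and> partial2 f s t \<le> B"
    using partials_bounded[of M] by blast
  \<comment> \<open>Chosen such that \<open>\<kappa> * \<eta> powr - \<alpha> = B + 1\<close>.\<close>
  define \<eta> where "\<eta> = ((B + 1) / \<kappa>) powr (- 1 / \<alpha>)"
  have \<eta>: "0 < \<eta>" using B(1) \<kappa> by (simp add: \<eta>_def)
  have "- \<kappa> * d powr - \<alpha> * ((u - U) + max 0 (v - V)) \<le> f U V - f u v"
    if d: "0 < d" "d < \<eta>" and uv: "u \<le> M" "v \<le> M" and pos: "0 < U" "U < u" "0 < V" "0 < v"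
    for d u v U V
  proof -
    have "- B * (u - U) - B * max 0 (v - V) \<le> f U V - f u v"
      using B uv by (intro difference_lower_bound[OF pos]) auto
    moreover have "B \<le> \<kappa> * d powr - \<alpha>"
    proof -
      have "\<eta> powr - \<alpha> = (B + 1) / \<kappa>"
        using exponents_pos(1) B(1) \<kappa> by (simp add: \<eta>_def powr_powr)
      moreover have "\<eta> powr - \<alpha> \<le> d powr - \<alpha>"
        using d exponents_pos(1) by (intro powr_mono2') auto
      ultimately have "(B + 1) / \<kappa> \<le> d powr - \<alpha>" by simp
      then show ?thesis using \<kappa> by (simp add: field_simps)
    qed
    then have "B * (u - U + max 0 (v - V)) \<le> \<kappa> * d powr - \<alpha> * (u - U + max 0 (v - V))"
      using pos by (intro mult_right_mono) auto
    ultimately show ?thesis by (simp add: distrib_left)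
  qed
  then show ?thesis using \<eta> by blast
qed

text \<open>With \<open>w\<close> the depth of the minimum, the maximum principle bounds the difference of the right-hand sides
above by \<open>- k * d powr - \<alpha> * w\<close>, and the structure of \<open>f\<close> bounds it below by
\<open>- (k / 3) * d powr - \<alpha> * (w + Z)\<close>. Cancelling the weight gives \<open>w \<le> (w + Z) / 3\<close>,
that is, \<open>w \<le> Z / 2\<close>.\<close>

lemma antisymmetric_minimum_dominated:
  fixes u v :: "'a::euclidean_space \<Rightarrow> real"
  assumes C: "0 < C" and \<alpha>2: "\<alpha> < 2" and u: "u \<in> L_space \<alpha> \<inter> C11_loc"
    and eq: "\<And>x. frac_laplacian C \<alpha> u x = f (u x) (v x)"
    and pos: "\<And>x. 0 < u x" "\<And>x. 0 < v x" and M: "\<And>x. u x \<le> M" "\<And>x. v x \<le> M"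
    and decay: "lesssim_infinity u (\<lambda>x. norm x powr - a)" "lesssim_infinity v (\<lambda>x. norm x powr - b)"
  shows "\<exists>R>0. \<exists>\<eta>>0. negative_minima_dominated u v R \<eta>"
proof -
  define k where "k = C * unit_ball_vol DIM('a) * 6 powr - (real DIM('a) + \<alpha>)"
  have k: "0 < k / 3" using C by (simp add: k_def)
  obtain R1 where R1: "\<And>x. R1 < norm x \<Longrightarrow> u x \<le> norm x powr - a"
    using decay(1) unfolding lesssim_infinity_def by blast
  obtain R2 where R2: "\<And>x. R2 < norm x \<Longrightarrow> v x \<le> norm x powr - b"
    using decay(2) unfolding lesssim_infinity_def by blast
  from difference_lower_bound_far[OF k] obtain R3 where "0 < R3" and
    far: "\<And>\<rho> d u v U V. R3 < \<rho> \<Longrightarrow> 0 < d \<Longrightarrow> d \<le> 2 * \<rho> \<Longrightarrow> u \<le> \<rho> powr - a \<Longrightarrow> v \<le> \<rho> powr - b \<Longrightarrow>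
      0 < U \<Longrightarrow> U < u \<Longrightarrow> 0 < V \<Longrightarrow> 0 < v \<Longrightarrow>
      - (k / 3) * d powr - \<alpha> * ((u - U) + max 0 (v - V)) \<le> f U V - f u v"
    by blast
  from difference_lower_bound_narrow[OF k, of M] obtain \<eta> where \<eta>: "0 < \<eta>" and
    narrow: "\<And>d u v U V. 0 < d \<Longrightarrow> d < \<eta> \<Longrightarrow> u \<le> M \<Longrightarrow> v \<le> M \<Longrightarrow>
      0 < U \<Longrightarrow> U < u \<Longrightarrow> 0 < V \<Longrightarrow> 0 < v \<Longrightarrow>
      - (k / 3) * d powr - \<alpha> * ((u - U) + max 0 (v - V)) \<le> f U V - f u v"
    by blast
  define R where "R = max R3 (max R1 R2)"
  have "- reflection_difference e l u x \<le> Z / 2"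
    if e: "norm e = 1" and x: "x \<bullet> e < l"
      and min: "\<And>y. y \<bullet> e < l \<Longrightarrow> reflection_difference e l u x \<le> reflection_difference e l u y"
      and neg: "reflection_difference e l u x < 0" and Z: "0 \<le> Z" "- Z \<le> reflection_difference e l v x"
      and good: "R < norm x \<and> \<bar>l\<bar> \<le> norm x \<or> l - x \<bullet> e < \<eta>"
    for e l x Z
  proof -
    define x' where "x' = hyperplane_reflection e l x"
    define d where "d = l - x \<bullet> e"
    define w where "w = u x - u x'"
    have w: "reflection_difference e l u x = - w" by (simp add: w_def x'_def reflection_difference_def)
    have d: "0 < d" using x by (simp add: d_def)
    have wpos: "0 < w" using neg w by simp
    have lower: "- (k / 3) * d powr - \<alpha> * (w + max 0 (v x - v x')) \<le> f (u x') (v x') - f (u x) (v x)"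
    proof (cases "d < \<eta>")
      case True
      then show ?thesis using narrow[OF d True M pos(1) _ pos(2) pos(2)] wpos unfolding w_def by simp
    next
      case False
      then have far_x: "R < norm x" "\<bar>l\<bar> \<le> norm x" using good by (auto simp: d_def)
      have "\<bar>x \<bullet> e\<bar> \<le> norm x" using Cauchy_Schwarz_ineq2[of x e] e by simp
      then have "d \<le> 2 * norm x" using far_x unfolding d_def by linarith
      then show ?thesis
        using far[of "norm x" d "u x" "v x" "u x'" "v x'"] far_x R1[of x] R2[of x] d pos wpos
        by (simp add: R_def w_def)
    qed
    have "f (u x') (v x') - f (u x) (v x) \<le> k * d powr - \<alpha> * (- w)"
      using frac_laplacian_at_antisymmetric_minimum[OF u _ C exponents_pos(1) \<alpha>2 e x min, of M] M pos neg
      by (simp add: eq k_def d_def w x'_def abs_le_iff order_trans[of "- u _" 0] less_imp_le)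
    with lower have "k * d powr - \<alpha> * w \<le> k * d powr - \<alpha> * ((w + max 0 (v x - v x')) / 3)" by simp
    then have "w \<le> (w + max 0 (v x - v x')) / 3"
      using k d by (subst (asm) mult_le_cancel_left_pos) auto
    moreover have "max 0 (v x - v x') \<le> Z" using Z by (simp add: reflection_difference_def x'_def)
    moreover have "w \<le> Z / 2" if "w \<le> (w + t) / 3" "t \<le> Z" for t using that by (simp add: field_simps)
    ultimately show ?thesis unfolding w minus_minus by blast
  qed
  then have "negative_minima_dominated u v R \<eta>"
    unfolding negative_minima_dominated_def by blast
  moreover have "0 < R" using \<open>0 < R3\<close> by (simp add: R_def)
  ultimately show ?thesis using \<eta> by blast
qed

text \<open>At an interior zero of the first reflection difference, monotonicity of \<open>f\<close> in its second argument
gives the sign opposite to that of the strong maximum principle, so that this reflection difference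
vanishes identically. Then every \<open>y\<close> is such a zero, the maximum principle yields that the right-hand
side does not increase from \<open>y\<close> to its mirror image, and by strict monotonicity neither does \<open>v\<close>.\<close>

lemma interior_zero_imp_zero:
  fixes u v :: "'a::euclidean_space \<Rightarrow> real"
  assumes C: "0 < C" and \<alpha>2: "\<alpha> < 2" and u: "u \<in> L_space \<alpha> \<inter> C11_loc"
    and eq: "\<And>x. frac_laplacian C \<alpha> u x = f (u x) (v x)"
    and pos: "\<And>x. 0 < u x" "\<And>x. 0 < v x" and M: "\<And>x. u x \<le> M"
    and e: "norm e = 1"
    and nonneg: "\<And>y. y \<bullet> e < l \<Longrightarrow> 0 \<le> reflection_difference e l u y"
      "\<And>y. y \<bullet> e < l \<Longrightarrow> 0 \<le> reflection_difference e l v y"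
    and x: "x \<bullet> e < l" "reflection_difference e l u x = 0"
    and y: "y \<bullet> e < l"
  shows "reflection_difference e l u y = 0 \<and> reflection_difference e l v y = 0"
proof -
  have mono: "f (u z) (v z) \<le> f (u (hyperplane_reflection e l z)) (v (hyperplane_reflection e l z))"
      and strict: "0 < reflection_difference e l v z \<Longrightarrow>
        f (u z) (v z) < f (u (hyperplane_reflection e l z)) (v (hyperplane_reflection e l z))"
    if "z \<bullet> e < l" "reflection_difference e l u z = 0" for z
    using that nonneg(2)[OF that(1)] pos
      strict_mono_second[of "u z" "v z" "v (hyperplane_reflection e l z)"]
    by (auto simp: reflection_difference_def le_less)
  have Mabs: "\<bar>u z\<bar> \<le> M" for z using M[of z] pos(1)[of z] by simp
  have zero: "reflection_difference e l u z = 0" if z: "z \<bullet> e < l" for z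
  proof (rule ccontr)
    assume "reflection_difference e l u z \<noteq> 0"
    then have "0 < reflection_difference e l u z" using nonneg(1)[OF z] by simp
    from frac_laplacian_at_interior_zero[OF u Mabs C exponents_pos(1) \<alpha>2 e x(1) nonneg(1) x(2) z this]
    show False using mono[OF x] by (simp add: eq)
  qed
  have "\<not> 0 < reflection_difference e l v y"
  proof
    assume "0 < reflection_difference e l v y"
    then have lt: "f (u y) (v y) < f (u (hyperplane_reflection e l y)) (v (hyperplane_reflection e l y))"
      using strict[OF y zero[OF y]] by simp
    have "frac_laplacian C \<alpha> u (hyperplane_reflection e l y) - frac_laplacian C \<alpha> u y \<le> 0"
      using frac_laplacian_at_antisymmetric_minimum[OF u Mabs C exponents_pos(1) \<alpha>2 e y] zero y by simp
    then show False using lt by (simp add: eq)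
  qed
  then show ?thesis using zero[OF y] nonneg(2)[OF y] by simp
qed

end

section \<open>Moving planes\<close>

lemma reflection_difference_continuous:
  fixes u :: "'a::euclidean_space \<Rightarrow> real"
  assumes "continuous_on UNIV u" "continuous_on S l" "continuous_on S x"
  shows "continuous_on S (\<lambda>t. reflection_difference e (l t) u (x t))"
  unfolding reflection_difference_def
  by (intro continuous_intros continuous_on_compose2[OF assms(1)] assms(2,3)) auto

text \<open>The reflection difference vanishes on the hyperplane, and at infinity it is bounded below by
\<open>- u\<close>, which tends to zero; so its negative values are controlled by a compact set.\<close>

lemma negative_minimum_attained:
  fixes u :: "'a::euclidean_space \<Rightarrow> real"
  assumes cont: "continuous_on UNIV u" and pos: "\<And>x. 0 < u x"
    and vanish: "\<And>c. 0 < c \<Longrightarrow> \<exists>R. \<forall>x. R < norm x \<longrightarrow> u x < c"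
    and x1: "x1 \<bullet> e < l" "reflection_difference e l u x1 < 0"
  obtains x where "x \<bullet> e < l" "reflection_difference e l u x < 0"
    "\<And>y. y \<bullet> e < l \<Longrightarrow> reflection_difference e l u x \<le> reflection_difference e l u y"
proof -
  let ?w = "reflection_difference e l u"
  obtain R where R: "\<And>x. R < norm x \<Longrightarrow> u x < - ?w x1" using vanish[of "- ?w x1"] x1(2) by auto
  have far: "?w x1 < ?w y" if "R < norm y" for y
    using R[OF that] pos[of "hyperplane_reflection e l y"] by (simp add: reflection_difference_def)
  define K where "K = {x. x \<bullet> e \<le> l} \<inter> cball 0 R"
  have "compact K" unfolding K_def
    by (intro closed_Int_compact compact_cball closed_Collect_le continuous_intros)
  moreover have "x1 \<in> K" using far[of x1] x1(1) by (force simp: K_def)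
  moreover have "continuous_on K ?w"
    by (intro reflection_difference_continuous[OF cont] continuous_intros)
  ultimately obtain x where x: "x \<in> K" "\<And>y. y \<in> K \<Longrightarrow> ?w x \<le> ?w y"
    using continuous_attains_inf[of K ?w] by blast
  have le: "?w x \<le> ?w x1" by (rule x(2)) fact
  then have neg: "?w x < 0" using x1(2) by simp
  have "x \<bullet> e \<noteq> l"
  proof
    assume "x \<bullet> e = l"
    then have "?w x = 0" by (simp add: reflection_difference_def hyperplane_reflection_def)
    then show False using neg by simp
  qed
  then have "x \<bullet> e < l" using x(1) by (simp add: K_def)
  moreover have "?w x \<le> ?w y" if "y \<bullet> e < l" for y
    using x(2)[of y] far[of y] le that by (cases "R < norm y") (auto simp: K_def)
  ultimately show thesis using that neg by blast
qed

text \<open>The moving plane method separated from the equations. They enter through two facts only: negative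
minima in the critical regions dominate each other, and two nonnegative reflection differences are
either both strictly positive or both identically zero.\<close>

locale moving_plane_pair =
  fixes u v :: "'a::euclidean_space \<Rightarrow> real" and R \<eta> :: real
  assumes cont: "continuous_on UNIV u" "continuous_on UNIV v"
    and pos: "\<And>x. 0 < u x" "\<And>x. 0 < v x"
    and vanish: "\<And>c. 0 < c \<Longrightarrow> \<exists>R. \<forall>x. R < norm x \<longrightarrow> u x < c"
      "\<And>c. 0 < c \<Longrightarrow> \<exists>R. \<forall>x. R < norm x \<longrightarrow> v x < c"
    and R: "0 < R" and \<eta>: "0 < \<eta>"
    and dominated: "negative_minima_dominated u v R \<eta>" "negative_minima_dominated v u R \<eta>"
    and dichotomy_u: "\<And>e l x y. norm e = 1 \<Longrightarrow>
      (\<And>y. y \<bullet> e < l \<Longrightarrow> 0 \<le> reflection_difference e l u y \<and> 0 \<le> reflection_difference e l v y) \<Longrightarrow>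
      x \<bullet> e < l \<Longrightarrow> reflection_difference e l u x = 0 \<Longrightarrow> y \<bullet> e < l \<Longrightarrow>
      reflection_difference e l u y = 0 \<and> reflection_difference e l v y = 0"
    and dichotomy_v: "\<And>e l x y. norm e = 1 \<Longrightarrow>
      (\<And>y. y \<bullet> e < l \<Longrightarrow> 0 \<le> reflection_difference e l u y \<and> 0 \<le> reflection_difference e l v y) \<Longrightarrow>
      x \<bullet> e < l \<Longrightarrow> reflection_difference e l v x = 0 \<Longrightarrow> y \<bullet> e < l \<Longrightarrow>
      reflection_difference e l u y = 0 \<and> reflection_difference e l v y = 0"
begin

definition plane_below :: "'a \<Rightarrow> real \<Rightarrow> bool" where
  "plane_below e l \<longleftrightarrow>
     (\<forall>x. x \<bullet> e < l \<longrightarrow> 0 \<le> reflection_difference e l u x \<and> 0 \<le> reflection_difference e l v x)"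

text \<open>At the minima of the two reflection differences, each depth is at most half the other one.\<close>

lemma plane_below_if_negative_near:
  assumes e: "norm e = 1"
    and near: "\<And>x. x \<bullet> e < l \<Longrightarrow> reflection_difference e l u x < 0 \<or> reflection_difference e l v x < 0 \<Longrightarrow>
      R < norm x \<and> \<bar>l\<bar> \<le> norm x \<or> l - x \<bullet> e < \<eta>"
  shows "plane_below e l"
proof -
  let ?w = "reflection_difference e l u" and ?z = "reflection_difference e l v"
  have u_neg: "\<exists>x. x \<bullet> e < l \<and> ?w x < 0 \<and> (\<forall>y. y \<bullet> e < l \<longrightarrow> ?w x \<le> ?w y) \<and>
      (\<forall>Z\<ge>0. - Z \<le> ?z x \<longrightarrow> - ?w x \<le> Z / 2)" if x1: "x1 \<bullet> e < l" "?w x1 < 0" for x1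
  proof -
    obtain x where x: "x \<bullet> e < l" "?w x < 0" "\<And>y. y \<bullet> e < l \<Longrightarrow> ?w x \<le> ?w y"
      using negative_minimum_attained[OF cont(1) pos(1) vanish(1) x1] by blast
    then show ?thesis using negative_minima_dominatedD[OF dominated(1) e x(1,3,2)] near[OF x(1)] by blast
  qed
  have v_neg: "\<exists>x. x \<bullet> e < l \<and> ?z x < 0 \<and> (\<forall>y. y \<bullet> e < l \<longrightarrow> ?z x \<le> ?z y) \<and>
      (\<forall>Z\<ge>0. - Z \<le> ?w x \<longrightarrow> - ?z x \<le> Z / 2)" if x1: "x1 \<bullet> e < l" "?z x1 < 0" for x1
  proof -
    obtain x where x: "x \<bullet> e < l" "?z x < 0" "\<And>y. y \<bullet> e < l \<Longrightarrow> ?z x \<le> ?z y"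
      using negative_minimum_attained[OF cont(2) pos(2) vanish(2) x1] by blast
    then show ?thesis using negative_minima_dominatedD[OF dominated(2) e x(1,3,2)] near[OF x(1)] by blast
  qed
  show ?thesis
  proof (rule ccontr)
    assume "\<not> plane_below e l"
    then obtain x1 where "x1 \<bullet> e < l" "?w x1 < 0 \<or> ?z x1 < 0"
      unfolding plane_below_def by force
    moreover have u_nonneg: False if x1: "x1 \<bullet> e < l" "?w x1 < 0" for x1
    proof -
      obtain x where x: "x \<bullet> e < l" "?w x < 0" "\<forall>y. y \<bullet> e < l \<longrightarrow> ?w x \<le> ?w y"
          "\<forall>Z\<ge>0. - Z \<le> ?z x \<longrightarrow> - ?w x \<le> Z / 2"
        using u_neg[OF x1] by (elim exE conjE)
      have "?z x < 0" using x(4)[rule_format, of 0] x(2) by linarith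
      obtain x' where x': "x' \<bullet> e < l" "?z x' < 0" "\<forall>y. y \<bullet> e < l \<longrightarrow> ?z x' \<le> ?z y"
          "\<forall>Z\<ge>0. - Z \<le> ?w x' \<longrightarrow> - ?z x' \<le> Z / 2"
        using v_neg[OF x(1) \<open>?z x < 0\<close>] by (elim exE conjE)
      have "- ?w x \<le> - ?z x' / 2"
        using x'(3)[rule_format, OF x(1)] x'(2) by (intro x(4)[rule_format]) simp_all
      moreover have "- ?z x' \<le> - ?w x / 2"
        using x(3)[rule_format, OF x'(1)] x(2) by (intro x'(4)[rule_format]) simp_all
      ultimately show False using x(2) by linarith
    qed
    moreover have False if x1: "x1 \<bullet> e < l" "?z x1 < 0" for x1
    proof -
      obtain x where x: "x \<bullet> e < l" "?z x < 0" "\<forall>Z\<ge>0. - Z \<le> ?w x \<longrightarrow> - ?z x \<le> Z / 2"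
        using v_neg[OF x1] by (elim exE conjE)
      have "?w x < 0" using x(3)[rule_format, of 0] x(2) by linarith
      then show False using u_nonneg x(1) by blast
    qed
    ultimately show False by blast
  qed
qed

text \<open>For \<open>l \<le> - R\<close> the whole half-space consists of far points.\<close>

lemma plane_below_start:
  assumes e: "norm e = 1" and l: "l \<le> - R"
  shows "plane_below e l"
proof (rule plane_below_if_negative_near[OF e])
  fix x assume "x \<bullet> e < l"
  moreover have "\<bar>x \<bullet> e\<bar> \<le> norm x" using Cauchy_Schwarz_ineq2[of x e] e by simp
  ultimately show "R < norm x \<and> \<bar>l\<bar> \<le> norm x \<or> l - x \<bullet> e < \<eta>" using l R by linarith
qed

text \<open>For large \<open>l\<close> the mirror image of the origin is so far away that \<open>u\<close> is smaller there.\<close>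

lemma plane_below_bounded:
  assumes e: "norm e = 1"
  obtains L where "\<And>l. plane_below e l \<Longrightarrow> l \<le> L"
proof -
  obtain R' where R': "\<And>x. R' < norm x \<Longrightarrow> u x < u 0" using vanish(1)[OF pos(1), of 0] by blast
  have "\<not> plane_below e l" if "max 0 R' < l" for l
  proof -
    have "u ((2 * l) *\<^sub>R e) < u 0" using that e by (intro R') simp
    then have "reflection_difference e l u 0 < 0"
      by (simp add: reflection_difference_def hyperplane_reflection_def)
    moreover have "0 \<bullet> e < l" using that by simp
    ultimately show ?thesis unfolding plane_below_def by (meson not_le)
  qed
  then show thesis using that by (meson not_le)
qed

lemma plane_below_left_closed:
  assumes below: "\<And>m. m < l \<Longrightarrow> plane_below e m"
  shows "plane_below e l"
  unfolding plane_below_def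
proof (intro allI impI)
  fix x assume x: "x \<bullet> e < l"
  have nonneg: "0 \<le> reflection_difference e l h x"
    if h: "continuous_on UNIV h" "\<And>m. m < l \<Longrightarrow> x \<bullet> e < m \<Longrightarrow> 0 \<le> reflection_difference e m h x" for h
  proof -
    have "continuous_on UNIV (\<lambda>m. reflection_difference e m h x)"
      by (intro reflection_difference_continuous[OF h(1)] continuous_intros)
    then have "((\<lambda>m. reflection_difference e m h x) \<longlongrightarrow> reflection_difference e l h x) (at_left l)"
      by (simp add: continuous_on_eq_continuous_at isCont_def filterlim_at_split)
    moreover have "\<forall>\<^sub>F m in at_left l. 0 \<le> reflection_difference e m h x"
      using eventually_at_left_real[OF x] by eventually_elim (use h(2) in auto)
    ultimately show ?thesis by (rule tendsto_lowerbound) simp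
  qed
  show "0 \<le> reflection_difference e l u x \<and> 0 \<le> reflection_difference e l v x"
    using below by (intro conjI nonneg cont) (auto simp: plane_below_def)
qed

lemma positive_on_compact_persists:
  fixes h :: "'a \<Rightarrow> real"
  assumes h: "continuous_on UNIV h" and K: "compact K"
    and pos: "\<And>x. x \<in> K \<Longrightarrow> 0 < reflection_difference e l h x"
  obtains \<epsilon> where "0 < \<epsilon>" "\<And>m x. l \<le> m \<Longrightarrow> m < l + \<epsilon> \<Longrightarrow> x \<in> K \<Longrightarrow> 0 < reflection_difference e m h x"
proof (cases "K = {}")
  case True
  then show thesis using that[of 1] by simp
next
  case False
  let ?\<phi> = "\<lambda>p. reflection_difference e (fst p) h (snd p)"
  have "continuous_on ({l..l + 1} \<times> K) ?\<phi>"
    by (intro reflection_difference_continuous[OF h] continuous_intros)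
  then have uc: "uniformly_continuous_on ({l..l + 1} \<times> K) ?\<phi>"
    using K by (intro compact_uniformly_continuous compact_Times) auto
  have "continuous_on K (reflection_difference e l h)"
    by (intro reflection_difference_continuous[OF h] continuous_intros)
  then obtain x0 where x0: "x0 \<in> K" "\<And>x. x \<in> K \<Longrightarrow> reflection_difference e l h x0 \<le> reflection_difference e l h x"
    using continuous_attains_inf[OF K False] by blast
  obtain d where d: "0 < d" "\<And>p q. p \<in> {l..l + 1} \<times> K \<Longrightarrow> q \<in> {l..l + 1} \<times> K \<Longrightarrow> dist q p < d \<Longrightarrow>
      dist (?\<phi> q) (?\<phi> p) < reflection_difference e l h x0"
    using uc pos[OF x0(1)] unfolding uniformly_continuous_on_def by metis
  show thesis
  proof (rule that[of "min d 1"])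
    fix m x assume m: "l \<le> m" "m < l + min d 1" and x: "x \<in> K"
    have "dist (?\<phi> (m, x)) (?\<phi> (l, x)) < reflection_difference e l h x0"
      using m x by (intro d(2)) (auto simp: dist_Pair_Pair dist_real_def)
    then show "0 < reflection_difference e m h x"
      using x0(2)[OF x] by (simp add: dist_real_def)
  qed (use d in simp)
qed

text \<open>Outside a compact set \<open>K\<close> in the open half-space, all points are far from the origin or close to
every hyperplane slightly beyond the present one, where negative values are harmless. On \<open>K\<close>
strict positivity persists under small displacements.\<close>

lemma plane_below_advances:
  assumes e: "norm e = 1"
    and pos_u: "\<And>x. x \<bullet> e < l \<Longrightarrow> 0 < reflection_difference e l u x"
    and pos_v: "\<And>x. x \<bullet> e < l \<Longrightarrow> 0 < reflection_difference e l v x"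
  obtains \<epsilon> where "0 < \<epsilon>" "\<And>m. l \<le> m \<Longrightarrow> m < l + \<epsilon> \<Longrightarrow> plane_below e m"
proof -
  \<comment> \<open>The summand \<open>1\<close> is for the hyperplanes beyond \<open>l\<close>: points outside the ball satisfy \<open>\<bar>m\<bar> \<le> norm x\<close> for all \<open>m < l + 1\<close>.\<close>
  define R' where "R' = max R (\<bar>l\<bar> + 1)"
  define K where "K = {x. x \<bullet> e \<le> l - \<eta> / 2} \<inter> cball 0 R'"
  have K: "compact K" unfolding K_def
    by (intro closed_Int_compact compact_cball closed_Collect_le continuous_intros)
  have less: "x \<bullet> e < l" if "x \<in> K" for x using that \<eta> by (simp add: K_def)
  obtain \<epsilon>1 where \<epsilon>1: "0 < \<epsilon>1" "\<And>m x. l \<le> m \<Longrightarrow> m < l + \<epsilon>1 \<Longrightarrow> x \<in> K \<Longrightarrow> 0 < reflection_difference e m u x"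
    using positive_on_compact_persists[OF cont(1) K pos_u[OF less]] by blast
  obtain \<epsilon>2 where \<epsilon>2: "0 < \<epsilon>2" "\<And>m x. l \<le> m \<Longrightarrow> m < l + \<epsilon>2 \<Longrightarrow> x \<in> K \<Longrightarrow> 0 < reflection_difference e m v x"
    using positive_on_compact_persists[OF cont(2) K pos_v[OF less]] by blast
  define \<epsilon> where "\<epsilon> = min (min \<epsilon>1 \<epsilon>2) (min 1 (\<eta> / 2))"
  show thesis
  proof (rule that[of \<epsilon>])
    show "0 < \<epsilon>" using \<epsilon>1(1) \<epsilon>2(1) \<eta> by (simp add: \<epsilon>_def)
    fix m assume m: "l \<le> m" "m < l + \<epsilon>"
    show "plane_below e m"
    proof (rule plane_below_if_negative_near[OF e])
      fix x assume "reflection_difference e m u x < 0 \<or> reflection_difference e m v x < 0"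
      moreover have "m < l + \<epsilon>1" "m < l + \<epsilon>2" using m unfolding \<epsilon>_def by linarith+
      ultimately have "x \<notin> K" using \<epsilon>1(2)[of m x] \<epsilon>2(2)[of m x] m(1) by auto
      then show "R < norm x \<and> \<bar>m\<bar> \<le> norm x \<or> m - x \<bullet> e < \<eta>"
        using m by (auto simp: K_def R'_def \<epsilon>_def)
    qed
  qed
qed

text \<open>The plane is moved as far as possible. At the supremum the reflection differences are nonnegative,
but not both positive everywhere, as the plane could advance otherwise; hence one of them
has a zero, and both vanish identically.\<close>

lemma symmetric_about_some_hyperplane:
  assumes e: "norm e = 1"
  shows "\<exists>l. \<forall>x. u (hyperplane_reflection e l x) = u x \<and> v (hyperplane_reflection e l x) = v x"
proof -
  define S where "S = {l. \<forall>m\<le>l. plane_below e m}"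
  define l where "l = Sup S"
  obtain L where L: "\<And>l. plane_below e l \<Longrightarrow> l \<le> L" using plane_below_bounded[OF e] by blast
  have ne: "- R \<in> S" using plane_below_start[OF e] by (auto simp: S_def)
  have bdd: "bdd_above S" using L by (intro bdd_aboveI[of _ L]) (auto simp: S_def)
  have less: "plane_below e m" if m: "m < l" for m
  proof -
    obtain s where "s \<in> S" "m < s" using less_cSupE[of m S] m ne unfolding l_def by blast
    then show ?thesis by (auto simp: S_def)
  qed
  have below: "plane_below e l" using plane_below_left_closed less by blast
  then have nonneg: "\<And>y. y \<bullet> e < l \<Longrightarrow> 0 \<le> reflection_difference e l u y \<and> 0 \<le> reflection_difference e l v y"
    by (simp add: plane_below_def)
  have "\<exists>x. x \<bullet> e < l \<and> (reflection_difference e l u x = 0 \<or> reflection_difference e l v x = 0)"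
  proof (rule ccontr)
    assume "\<not> ?thesis"
    then have "0 < reflection_difference e l u x" "0 < reflection_difference e l v x" if "x \<bullet> e < l" for x
      using nonneg[OF that] that by (auto simp: le_less)
    then obtain \<epsilon> where \<epsilon>: "0 < \<epsilon>" "\<And>m. l \<le> m \<Longrightarrow> m < l + \<epsilon> \<Longrightarrow> plane_below e m"
      using plane_below_advances[OF e] by blast
    then have "l + \<epsilon> / 2 \<in> S" using less unfolding S_def by (force simp: not_less[symmetric])
    then have "l + \<epsilon> / 2 \<le> l" unfolding l_def using bdd by (rule cSup_upper)
    then show False using \<epsilon>(1) by simp
  qed
  then have zero: "reflection_difference e l u y = 0 \<and> reflection_difference e l v y = 0" if "y \<bullet> e < l" for y
    using dichotomy_u[OF e nonneg _ _ that] dichotomy_v[OF e nonneg _ _ that] by blast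
  have "u (hyperplane_reflection e l x) = u x \<and> v (hyperplane_reflection e l x) = v x" for x
  proof -
    consider "x \<bullet> e < l" | "x \<bullet> e = l" | "hyperplane_reflection e l x \<bullet> e < l"
      unfolding hyperplane_reflection_inner[OF e] by linarith
    then show ?thesis
    proof cases
      case 1
      then show ?thesis using zero[of x] by (simp add: reflection_difference_def)
    next
      case 2
      then show ?thesis by (simp add: hyperplane_reflection_def)
    next
      case 3
      then show ?thesis using zero[of "hyperplane_reflection e l x"]
        by (simp add: reflection_difference_def hyperplane_reflection_involution[OF e])
    qed
  qed
  then show ?thesis by blast
qed

end

section \<open>From hyperplanes to radial symmetry\<close>

text \<open>Two points at equal distance from \<open>x0\<close> are exchanged by the reflection in the hyperplane that
bisects the segment between them, and this hyperplane contains \<open>x0\<close>.\<close>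

lemma radially_symmetric_if_reflections:
  fixes u :: "'a::euclidean_space \<Rightarrow> real"
  assumes refl: "\<And>e x. norm e = 1 \<Longrightarrow> u (hyperplane_reflection e (x0 \<bullet> e) x) = u x"
  shows "radially_symmetric_about u x0"
proof -
  have eq: "u x = u y" if "norm (x - x0) = norm (y - x0)" for x y
  proof (cases "x = y")
    case False
    define n where "n = norm (y - x)"
    have n: "0 < n" using False by (simp add: n_def)
    define e where "e = (1 / n) *\<^sub>R (y - x)"
    have e: "norm e = 1" using n by (simp add: e_def n_def)
    have "(x - x0) \<bullet> (x - x0) = (y - x0) \<bullet> (y - x0)" using that by (simp add: dot_square_norm)
    then have "2 * ((x0 - x) \<bullet> (y - x)) = (y - x) \<bullet> (y - x)"
      by (simp add: inner_diff_left inner_diff_right inner_commute algebra_simps)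
    also have "\<dots> = n * n" by (simp add: n_def dot_square_norm power2_eq_square)
    finally have "(x0 - x) \<bullet> (y - x) = n * n / 2" by simp
    moreover have "x0 \<bullet> e - x \<bullet> e = (x0 - x) \<bullet> (y - x) / n"
      by (simp add: e_def inner_diff_left diff_divide_distrib)
    ultimately have "2 * (x0 \<bullet> e - x \<bullet> e) = n" using n by (simp only:) simp
    then have "hyperplane_reflection e (x0 \<bullet> e) x = y"
      using n by (simp add: hyperplane_reflection_def) (simp add: e_def)
    then show ?thesis using refl[OF e, of x] by simp
  qed simp
  have "u x = u (SOME y. norm (y - x0) = norm (x - x0))" for x
    using someI[of "\<lambda>y. norm (y - x0) = norm (x - x0)" x] by (intro eq) simp
  then show ?thesis unfolding radially_symmetric_about_def 
    by (intro exI[where x = "\<lambda>t. u (SOME y. norm (y - x0) = t)"] allI)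
qed

text \<open>The reflections in the directions of an orthonormal basis compose to the point reflection in a point
\<open>x0\<close>. Were some other symmetry hyperplane not to contain \<open>x0\<close>, the reflection in it and the point
reflection would generate a translation, and \<open>u\<close> would be periodic, which is impossible for a
positive function that vanishes at infinity.\<close>

lemma radial_if_symmetric_in_every_direction:
  fixes u v :: "'a::euclidean_space \<Rightarrow> real"
  assumes pos: "\<And>x. 0 < u x" and vanish: "\<And>c. 0 < c \<Longrightarrow> \<exists>R. \<forall>x. R < norm x \<longrightarrow> u x < c"
    and sym: "\<And>e. norm e = 1 \<Longrightarrow>
      \<exists>l. \<forall>x. u (hyperplane_reflection e l x) = u x \<and> v (hyperplane_reflection e l x) = v x"
  shows "\<exists>x0. radially_symmetric_about u x0 \<and> radially_symmetric_about v x0"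
proof -
  obtain l where l: "\<And>e x. norm e = 1 \<Longrightarrow>
      u (hyperplane_reflection e (l e) x) = u x \<and> v (hyperplane_reflection e (l e) x) = v x"
    using sym by metis
  define x0 :: 'a where "x0 = (\<Sum>i\<in>Basis. l i *\<^sub>R i)"
  have partial: "u (x + (\<Sum>i\<in>B. (2 * (l i - x \<bullet> i)) *\<^sub>R i)) = u x
      \<and> v (x + (\<Sum>i\<in>B. (2 * (l i - x \<bullet> i)) *\<^sub>R i)) = v x" if "finite B" "B \<subseteq> Basis" for x B
    using that
  proof (induction B)
    case (insert j B)
    let ?y = "x + (\<Sum>i\<in>B. (2 * (l i - x \<bullet> i)) *\<^sub>R i)"
    have "(\<Sum>i\<in>B. (2 * (l i - x \<bullet> i)) *\<^sub>R i) \<bullet> j = 0"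
      unfolding inner_sum_left
    proof (intro sum.neutral ballI)
      fix i assume "i \<in> B"
      then have "i \<bullet> j = 0" using insert.hyps insert.prems by (intro inner_not_same_Basis) auto
      then show "(2 * (l i - x \<bullet> i)) *\<^sub>R i \<bullet> j = 0" by simp
    qed
    then have "?y \<bullet> j = x \<bullet> j" unfolding inner_add_left by simp
    then have "hyperplane_reflection j (l j) ?y = x + (\<Sum>i\<in>insert j B. (2 * (l i - x \<bullet> i)) *\<^sub>R i)"
      using insert by (simp add: hyperplane_reflection_def)
    then show ?case using l[of j ?y] insert by simp
  qed simp
  have point: "u (2 *\<^sub>R x0 - x) = u x" for x
  proof -
    have "(\<Sum>i\<in>Basis. (2 * (l i - x \<bullet> i)) *\<^sub>R i) = 2 *\<^sub>R x0 - 2 *\<^sub>R (\<Sum>i\<in>Basis. (x \<bullet> i) *\<^sub>R i)"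
      unfolding x0_def by (simp add: scaleR_sum_right sum_subtractf[symmetric] algebra_simps)
    then have "x + (\<Sum>i\<in>Basis. (2 * (l i - x \<bullet> i)) *\<^sub>R i) = 2 *\<^sub>R x0 - x"
      unfolding euclidean_representation by (simp add: scaleR_2)
    then show ?thesis using partial[of Basis x] by simp
  qed
  have centre: "l e = x0 \<bullet> e" if e: "norm e = 1" for e
  proof (rule ccontr)
    assume "l e \<noteq> x0 \<bullet> e"
    define c where "c = 4 * (l e - x0 \<bullet> e)"
    have c: "c \<noteq> 0" using \<open>l e \<noteq> x0 \<bullet> e\<close> by (simp add: c_def)
    have shift: "u (x + c *\<^sub>R e) = u x" for x
    proof -
      let ?T = "hyperplane_reflection e (l e)" and ?P = "\<lambda>x. 2 *\<^sub>R x0 - x"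
      have "?T (?P (?T (?P x))) = x + c *\<^sub>R e"
        unfolding hyperplane_reflection_def c_def
        by (simp add: inner_add_left inner_diff_left inner_unit[OF e] algebra_simps scaleR_2)
          (simp add: scaleR_add_left[symmetric])
      then show ?thesis using l[OF e] point by metis
    qed
    have shifts: "u ((real k * c) *\<^sub>R e) = u 0" for k
    proof (induction k)
      case (Suc k)
      have "(real (Suc k) * c) *\<^sub>R e = (real k * c) *\<^sub>R e + c *\<^sub>R e"
        by (simp add: distrib_right scaleR_add_left)
      then show ?case using shift Suc by simp
    qed simp
    obtain R where R: "\<And>x. R < norm x \<Longrightarrow> u x < u 0" using vanish[OF pos, of 0] by blast
    obtain k :: nat where "R < real k * \<bar>c\<bar>" using reals_Archimedean3[of "\<bar>c\<bar>"] c by auto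
    then have "R < norm ((real k * c) *\<^sub>R e)" using e by (simp add: abs_mult)
    from R[OF this] shifts show False by simp
  qed
  have "radially_symmetric_about u x0 \<and> radially_symmetric_about v x0"
    using l centre by (intro conjI radially_symmetric_if_reflections) metis+
  then show ?thesis by blast
qed

section \<open>The symmetry theorem\<close>

lemma lesssim_infinity_powr_imp_vanish:
  fixes u :: "'a::euclidean_space \<Rightarrow> real"
  assumes decay: "lesssim_infinity u (\<lambda>x. norm x powr - a)" and a: "0 < a" and c: "0 < c"
  shows "\<exists>R. \<forall>x. R < norm x \<longrightarrow> u x < c"
proof -
  obtain R where R: "\<And>x. R < norm x \<Longrightarrow> u x \<le> norm x powr - a"
    using decay unfolding lesssim_infinity_def by blast
  have "\<forall>\<^sub>F \<rho> in at_top. \<rho> powr - a < c"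
    using a c by (intro order_tendstoD(2)[OF tendsto_neg_powr[OF _ filterlim_ident]]) auto
  then obtain R' where R': "\<And>\<rho>. R' \<le> \<rho> \<Longrightarrow> \<rho> powr - a < c"
    unfolding eventually_at_top_linorder by blast
  have "u x < c" if "max R R' < norm x" for x
    using R[of x] R'[of "norm x"] that by simp
  then show ?thesis by blast
qed

lemma continuous_vanishing_imp_bounded_above:
  fixes u :: "'a::euclidean_space \<Rightarrow> real"
  assumes cont: "continuous_on UNIV u" and vanish: "\<And>c. 0 < c \<Longrightarrow> \<exists>R. \<forall>x. R < norm x \<longrightarrow> u x < c"
  shows "\<exists>M. \<forall>x. u x \<le> M"
proof -
  obtain R where R: "\<And>x. R < norm x \<Longrightarrow> u x < 1" using vanish[of 1] by auto
  have "bounded (u ` cball 0 R)"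
    using cont by (intro compact_imp_bounded compact_continuous_image) (auto intro: continuous_on_subset)
  then obtain B where "\<forall>y\<in>u ` cball 0 R. norm y \<le> B" unfolding bounded_iff by blast
  then have B: "\<And>x. norm x \<le> R \<Longrightarrow> \<bar>u x\<bar> \<le> B" by simp
  have "u x \<le> max 1 B" for x
    using R[of x] B[of x] by (cases "R < norm x") auto
  then show ?thesis by blast
qed

theorem theorem1:
  fixes u v :: "real ^ 'n \<Rightarrow> real"
    and f g :: "real \<Rightarrow> real \<Rightarrow> real"
    and C \<alpha> a b p q r s :: real
  assumes C: "C > 0"
    and alpha: "0 < \<alpha>" "\<alpha> < 2"
    and f: "C1_on (\<lambda>(s, t). f s t) ({0..} \<times> {0..})"
    and g: "C1_on (\<lambda>(s, t). g s t) ({0..} \<times> {0..})"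
    and u: "u \<in> L_space \<alpha> \<inter> C11_loc"
    and v: "v \<in> L_space \<alpha> \<inter> C11_loc"
    and eq_u: "\<And>x. frac_laplacian C \<alpha> u x = f (u x) (v x)"
    and eq_v: "\<And>x. frac_laplacian C \<alpha> v x = g (u x) (v x)"
    and u_pos: "\<And>x. u x > 0"
    and v_pos: "\<And>x. v x > 0"
    and ab: "a > 0" "b > 0"
    and pqrs: "p \<ge> 1" "q \<ge> 1" "r \<ge> 1" "s \<ge> 1"
    and u_decay: "lesssim_infinity u (\<lambda>x. norm x powr (- a))"
    and v_decay: "lesssim_infinity v (\<lambda>x. norm x powr (- b))"
    and f_u: "lesssim_origin (partial1 f) (\<lambda>x y. x powr (p - 1) * y powr q)"
    and g_v: "lesssim_origin (partial2 g) (\<lambda>x y. x powr r * y powr (s - 1))"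
    and f_v: "lesssim_origin (partial2 f) (\<lambda>x y. x powr p * y powr (q - 1))"
    and g_u: "lesssim_origin (partial1 g) (\<lambda>x y. x powr (r - 1) * y powr s)"
    and f_v_pos: "\<And>x y. x > 0 \<Longrightarrow> y > 0 \<Longrightarrow> partial2 f x y > 0"
    and g_u_pos: "\<And>x y. x > 0 \<Longrightarrow> y > 0 \<Longrightarrow> partial1 g x y > 0"
    and exponents: "\<alpha> < Min {a * p + b * q - a, a * p + b * q - b,
                             a * r + b * s - a, a * r + b * s - b}"
  shows "\<exists>x0. radially_symmetric_about u x0 \<and> radially_symmetric_about v x0"
proof -
  have exps: "\<alpha> < a * p + b * q - a" "\<alpha> < a * p + b * q - b"
      "\<alpha> < b * s + a * r - b" "\<alpha> < b * s + a * r - a"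
    using exponents by (simp_all add: add.commute)
  interpret F: decaying_cooperative_nonlinearity f \<alpha> a b p q
    using C1_on_quadrant_partials[OF f] f_v_pos f_u f_v alpha ab pqrs exps by unfold_locales auto
  \<comment> \<open>The second equation is of the form of the first one after exchanging the roles of \<open>u\<close> and \<open>v\<close>.\<close>
  have swap: "partial1 (\<lambda>x y. g y x) = (\<lambda>x y. partial2 g y x)"
      "partial2 (\<lambda>x y. g y x) = (\<lambda>x y. partial1 g y x)"
    by (simp_all add: partial1_def partial2_def fun_eq_iff)
  interpret G: decaying_cooperative_nonlinearity "\<lambda>x y. g y x" \<alpha> b a s r
  proof
    show "lesssim_origin (partial1 (\<lambda>x y. g y x)) (\<lambda>x y. x powr (s - 1) * y powr r)"
      using g_v unfolding swap lesssim_origin_def by (metis add.commute mult.commute)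
    show "lesssim_origin (partial2 (\<lambda>x y. g y x)) (\<lambda>x y. x powr s * y powr (r - 1))"
      using g_u unfolding swap lesssim_origin_def by (metis add.commute mult.commute)
    show "\<exists>B\<ge>0. \<forall>x y. 0 < x \<longrightarrow> x \<le> M \<longrightarrow> 0 < y \<longrightarrow> y \<le> M \<longrightarrow>
        partial1 (\<lambda>x y. g y x) x y \<le> B \<and> partial2 (\<lambda>x y. g y x) x y \<le> B" for M
      using C1_on_quadrant_partials(3)[OF g, of M] unfolding swap by metis
  qed (use C1_on_quadrant_partials(1,2)[OF g] g_u_pos alpha ab pqrs exps in \<open>auto simp: swap\<close>)
  have cont: "continuous_on UNIV u" "continuous_on UNIV v" using u v C11_loc_continuous by auto
  note vanish = lesssim_infinity_powr_imp_vanish[OF u_decay ab(1)]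
    lesssim_infinity_powr_imp_vanish[OF v_decay ab(2)]
  obtain M1 M2 where "\<And>x. u x \<le> M1" "\<And>x. v x \<le> M2"
    using continuous_vanishing_imp_bounded_above[OF cont(1) vanish(1)]
      continuous_vanishing_imp_bounded_above[OF cont(2) vanish(2)] by blast
  then have M: "\<And>x. u x \<le> max M1 M2" "\<And>x. v x \<le> max M1 M2" by (simp_all add: le_max_iff_disj)
  obtain R1 \<eta>1 where 1: "0 < R1" "0 < \<eta>1" "negative_minima_dominated u v R1 \<eta>1"
    using F.antisymmetric_minimum_dominated[OF C alpha(2) u eq_u u_pos v_pos M u_decay v_decay] by blast
  obtain R2 \<eta>2 where 2: "0 < R2" "0 < \<eta>2" "negative_minima_dominated v u R2 \<eta>2"
    using G.antisymmetric_minimum_dominated[OF C alpha(2) v eq_v v_pos u_pos M(2,1) v_decay u_decay] by blast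
  interpret moving_plane_pair u v "max R1 R2" "min \<eta>1 \<eta>2"
  proof
    fix e :: "real ^ 'n" and l x y
    assume e: "norm e = 1" and
      nonneg: "\<And>y. y \<bullet> e < l \<Longrightarrow> 0 \<le> reflection_difference e l u y \<and> 0 \<le> reflection_difference e l v y"
      and x: "x \<bullet> e < l" and y: "y \<bullet> e < l"
    show "reflection_difference e l u y = 0 \<and> reflection_difference e l v y = 0"
      if "reflection_difference e l u x = 0"
      using F.interior_zero_imp_zero[OF C alpha(2) u eq_u u_pos v_pos M(1) e _ _ x that y] nonneg by blast
    show "reflection_difference e l u y = 0 \<and> reflection_difference e l v y = 0"
      if "reflection_difference e l v x = 0"
      using G.interior_zero_imp_zero[OF C alpha(2) v eq_v v_pos u_pos M(2) e _ _ x that y] nonneg by blast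
  next
    show "negative_minima_dominated u v (max R1 R2) (min \<eta>1 \<eta>2)"
      using 1(3) by (rule negative_minima_dominated_mono) auto
    show "negative_minima_dominated v u (max R1 R2) (min \<eta>1 \<eta>2)"
      using 2(3) by (rule negative_minima_dominated_mono) auto
  qed (use cont u_pos v_pos vanish 1 2 in auto)
  show ?thesis
    by (rule radial_if_symmetric_in_every_direction[OF u_pos vanish(1) symmetric_about_some_hyperplane])
qed

end
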